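(* Let $n$ be an even positive integer and let $\lambda = (n-r,1^r) \vdash n$ be a hook partition of $n$ (with $0\le r\le n-1$) such that $n-r \leq r$. Then, in characteristic $2$, $S_2^\lambda$ has a filtration by submodules whose successive factors are, from bottom to top, isomorphic to the modules \[S_2^{*(r,n-r)},\ S_2^{(r+2,n-r-2)},\ \ldots,\ S_2^{(r+2l,\, n-r-2l)},\ \ldots,\] where $l$ runs over $1\le l\le \lfloor (n-r)/2\rfloor$ after the bottom factor $S_2^{*(r,n-r)}$.
   Context: $\mathbb{F}$ is an arbitrary field of characteristic $2$ and $S_n$ is the symmetric group. For a partition $\lambda$ of $n$, $M^\lambda_2$ is the permutation module over $\mathbb{F}$ with basis the $\lambda$-tabloids, and the Specht module $S^\lambda_2\subseteq M^\lambda_2$ is the submodule spanned by the polytabloids $e_t=\sum_{\sigma\in C_t}\mathrm{sgn}(\sigma)\,\sigma\{t\}$, where $C_t$ is the group of permutations preserving each column of the $\lambda$-tableau $t$ (James's convention). For $n=2k$ even and $0\le i<k$, let $\hat\Theta_i: S_2^{(n-i,i)}\to S_2^{(n-i-1,i+1)}$ be the (unique up to scaling) non-zero $\mathbb{F}S_n$-homomorphism; explicitly, it is the restriction to $S_2^{(n-i,i)}$ of the homomorphism $M_2^{(n-i,i)}\to M_2^{(n-i-1,i+1)}$ sending a tabloid $\{s\}$ to the sum of all $(n-i-1,i+1)$-tabloids whose second row contains the second row of $\{s\}$ (the image of this restriction lies in $S_2^{(n-i-1,i+1)}$ because $n$ is even). For $1\le i\le k$, $S_2^{*(n-i,i)}$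 denotes the image of $\hat\Theta_{i-1}$, a submodule of $S_2^{(n-i,i)}$ isomorphic to a quotient of $S_2^{(n-i+1,i-1)}$. Thus $S_2^{*(r,n-r)}$ is the image of $\hat\Theta_{n-r-1}: S_2^{(r+1,n-r-1)}\to S_2^{(r,n-r)}$. *)

theory Defs
  imports "HOL-Combinatorics.Permutations" "HOL-Library.Function_Algebras" Complex_Main
begin

text \<open>
  The symmetric group \<open>S\<^sub>n\<close> is the set of all \<open>\<sigma>\<close> with \<open>\<sigma> permutes {1..n}\<close>.
  A partition is given by the list of its parts. Rows and columns are numbered from \<open>0\<close>, and
  trailing zero parts are allowed: \<open>[n, 0]\<close> has the same Young diagram as \<open>[n]\<close>, and
  its tabloid has an empty second row. Only the values of a tableau on the diagram matter.
\<close>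

definition diagram :: "nat list \<Rightarrow> (nat \<times> nat) set" where
  "diagram l = {(i, j). i < length l \<and> j < l ! i}"

definition tableaux :: "nat list \<Rightarrow> (nat \<times> nat \<Rightarrow> nat) set" where
  "tableaux l = {t. bij_betw t (diagram l) {1..sum_list l}}"

definition row :: "nat list \<Rightarrow> (nat \<times> nat \<Rightarrow> nat) \<Rightarrow> nat \<Rightarrow> nat set" where
  "row l t i = t ` {c \<in> diagram l. fst c = i}"

definition column :: "nat list \<Rightarrow> (nat \<times> nat \<Rightarrow> nat) \<Rightarrow> nat \<Rightarrow> nat set" where
  "column l t j = t ` {c \<in> diagram l. snd c = j}"

definition row_stabilizer :: "nat list \<Rightarrow> (nat \<times> nat \<Rightarrow> nat) \<Rightarrow> (nat \<Rightarrow> nat) set" where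
  "row_stabilizer l t =
     {\<sigma>. \<sigma> permutes {1..sum_list l} \<and> (\<forall>i. \<sigma> ` row l t i = row l t i)}"

definition column_stabilizer :: "nat list \<Rightarrow> (nat \<times> nat \<Rightarrow> nat) \<Rightarrow> (nat \<Rightarrow> nat) set" where
  "column_stabilizer l t =
     {\<sigma>. \<sigma> permutes {1..sum_list l} \<and> (\<forall>j. \<sigma> ` column l t j = column l t j)}"

text \<open>
  A tabloid, i.e. a row-equivalence class of tableaux, is represented by the list of its rows,
  each row being a set; the lemma \<open>tabloid_eq_iff\<close> below justifies this.
\<close>

type_synonym tabloid = "nat set list"

definition tabloid_of :: "nat list \<Rightarrow> (nat \<times> nat \<Rightarrow> nat) \<Rightarrow> tabloid" where
  "tabloid_of l t = map (row l t) [0..<length l]"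

definition tabloids :: "nat list \<Rightarrow> tabloid set" where
  "tabloids l = tabloid_of l ` tableaux l"

definition act_tabloid :: "(nat \<Rightarrow> nat) \<Rightarrow> tabloid \<Rightarrow> tabloid" where
  "act_tabloid \<sigma> T = map ((`) \<sigma>) T"

lemma tabloid_eq_iff:
  assumes "s \<in> tableaux l" "t \<in> tableaux l"
  shows "tabloid_of l s = tabloid_of l t \<longleftrightarrow>
    (\<exists>\<sigma> \<in> row_stabilizer l t. \<forall>c \<in> diagram l. s c = \<sigma> (t c))"
proof
  let ?D = "diagram l" and ?n = "sum_list l"
  have s: "bij_betw s ?D {1..?n}" and t: "bij_betw t ?D {1..?n}"
    using assms by (auto simp: tableaux_def)
  assume eq: "tabloid_of l s = tabloid_of l t"
  have rows: "row l s i = row l t i" for i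
  proof (cases "i < length l")
    case True
    then show ?thesis using eq by (simp add: tabloid_of_def)
  next
    case False
    then show ?thesis by (auto simp: row_def diagram_def)
  qed
  define \<sigma> where "\<sigma> = (\<lambda>x. if x \<in> {1..?n} then s (inv_into ?D t x) else x)"
  have val: "\<sigma> (t c) = s c" if "c \<in> ?D" for c
    using that t bij_betwE[OF t] by (auto simp: \<sigma>_def bij_betw_def inv_into_f_f)
  have "bij_betw (s \<circ> inv_into ?D t) {1..?n} {1..?n}"
    using bij_betw_trans[OF bij_betw_inv_into[OF t] s] .
  then have "bij_betw \<sigma> {1..?n} {1..?n}"
    by (rule bij_betw_cong[THEN iffD1, rotated]) (simp add: \<sigma>_def)
  then have perm: "\<sigma> permutes {1..?n}"
    by (rule bij_imp_permutes) (simp only: \<sigma>_def if_False)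
  have "\<sigma> ` row l t i = row l s i" for i
    using val by (force simp: row_def image_image intro!: image_cong)
  then show "\<exists>\<sigma> \<in> row_stabilizer l t. \<forall>c \<in> ?D. s c = \<sigma> (t c)"
    using perm val rows by (intro bexI[of _ \<sigma>]) (simp_all add: row_stabilizer_def)
next
  assume "\<exists>\<sigma> \<in> row_stabilizer l t. \<forall>c \<in> diagram l. s c = \<sigma> (t c)"
  then obtain \<sigma> where stab: "\<sigma> ` row l t i = row l t i"
    and val: "\<forall>c \<in> diagram l. s c = \<sigma> (t c)" for i
    by (auto simp: row_stabilizer_def)
  have "row l s i = \<sigma> ` row l t i" for i
    using val by (force simp: row_def image_image intro!: image_cong)
  then show "tabloid_of l s = tabloid_of l t"
    by (simp add: tabloid_of_def stab)
qed

text \<open>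
  Elements of permutation modules are functions from tabloids to the field, a tabloid \<open>T\<close>
  being identified with the indicator function \<open>single T\<close>.
\<close>

definition scale :: "'a::field \<Rightarrow> (tabloid \<Rightarrow> 'a) \<Rightarrow> tabloid \<Rightarrow> 'a" where
  "scale c f = (\<lambda>T. c * f T)"

global_interpretation tab: vector_space scale
  by standard (auto simp: scale_def fun_eq_iff algebra_simps)

definition single :: "tabloid \<Rightarrow> tabloid \<Rightarrow> 'a::field" where
  "single T = (\<lambda>X. if X = T then 1 else 0)"

text \<open>The linear action with \<open>act \<sigma> (single T) = single (act_tabloid \<sigma> T)\<close>:\<close>

definition act :: "(nat \<Rightarrow> nat) \<Rightarrow> (tabloid \<Rightarrow> 'a::field) \<Rightarrow> tabloid \<Rightarrow> 'a" where
  "act \<sigma> f = (\<lambda>T. f (act_tabloid (inv \<sigma>) T))"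

lemma act_single:
  assumes "bij \<sigma>"
  shows "act \<sigma> (single T) = single (act_tabloid \<sigma> T)"
proof -
  have "act_tabloid (inv \<sigma>) X = T \<longleftrightarrow> X = act_tabloid \<sigma> T" for X
    using assms by (auto simp: act_tabloid_def map_idI image_inv_f_f bij_is_inj image_f_inv_f bij_is_surj)
  then show ?thesis
    by (auto simp: act_def single_def fun_eq_iff)
qed

definition perm_module :: "nat list \<Rightarrow> (tabloid \<Rightarrow> 'a::field) set" where
  "perm_module l = tab.span (single ` tabloids l)"

definition polytabloid :: "nat list \<Rightarrow> (nat \<times> nat \<Rightarrow> nat) \<Rightarrow> tabloid \<Rightarrow> 'a::field" where
  "polytabloid l t = (\<Sum>\<sigma> \<in> column_stabilizer l t.
     scale (of_int (sign \<sigma>)) (single (act_tabloid \<sigma> (tabloid_of l t))))"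

definition specht :: "nat list \<Rightarrow> (tabloid \<Rightarrow> 'a::field) set" where
  "specht l = tab.span (polytabloid l ` tableaux l)"

lemma act_tabloid_in_tabloids:
  assumes "\<sigma> permutes {1..sum_list l}" "t \<in> tableaux l"
  shows "act_tabloid \<sigma> (tabloid_of l t) \<in> tabloids l"
proof -
  have "\<sigma> \<circ> t \<in> tableaux l"
    using assms bij_betw_trans permutes_imp_bij by (fastforce simp: tableaux_def)
  moreover have "act_tabloid \<sigma> (tabloid_of l t) = tabloid_of l (\<sigma> \<circ> t)"
    by (simp add: act_tabloid_def tabloid_of_def row_def image_comp)
  ultimately show ?thesis
    by (simp add: tabloids_def)
qed

lemma specht_subset_perm_module: "specht l \<subseteq> perm_module l"
  unfolding specht_def perm_module_def
proof (rule tab.span_minimal)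
  have "polytabloid l t \<in> tab.span (single ` tabloids l)" if "t \<in> tableaux l" for t
    unfolding polytabloid_def using that
    by (intro tab.span_sum tab.span_scale tab.span_base imageI act_tabloid_in_tabloids)
       (simp_all add: column_stabilizer_def)
  then show "polytabloid l ` tableaux l \<subseteq> tab.span (single ` tabloids l)"
    by blast
qed simp

text \<open>
  The map \<open>M\<^bsup>(a,b)\<^esup> \<rightarrow> M\<^bsup>(a-1,b+1)\<^esup>\<close>, extended linearly
  from tabloids; \<open>T ! 1\<close> is the second row of \<open>T\<close>.
\<close>

definition theta :: "nat \<Rightarrow> nat \<Rightarrow> (tabloid \<Rightarrow> 'a::field) \<Rightarrow> tabloid \<Rightarrow> 'a" where
  "theta a b f = (\<Sum>S \<in> tabloids [a, b].
     scale (f S) (\<Sum>T \<in> {T \<in> tabloids [a - 1, b + 1]. S ! 1 \<subseteq> T ! 1}. single T))"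

text \<open>\<open>S\<^bsup>*(a,b)\<^esup>\<close>, for \<open>a \<ge> b \<ge> 1\<close> with \<open>a + b\<close> even and characteristic 2:\<close>

definition specht_star :: "nat \<Rightarrow> nat \<Rightarrow> (tabloid \<Rightarrow> 'a::field) set" where
  "specht_star a b = theta (a + 1) (b - 1) ` specht [a + 1, b - 1]"

text \<open>
  An \<open>FS\<^sub>n\<close>-module is given by its carrier, its vector space operations and the action
  of permutations.
\<close>

record ('k, 'v) sn_module =
  m_carrier :: "'v set"
  m_add :: "'v \<Rightarrow> 'v \<Rightarrow> 'v"
  m_scale :: "'k \<Rightarrow> 'v \<Rightarrow> 'v"
  m_act :: "(nat \<Rightarrow> nat) \<Rightarrow> 'v \<Rightarrow> 'v"

definition tab_module :: "(tabloid \<Rightarrow> 'a::field) set \<Rightarrow> ('a, tabloid \<Rightarrow> 'a) sn_module" where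
  "tab_module V = \<lparr>m_carrier = V, m_add = (+), m_scale = scale, m_act = act\<rparr>"

text \<open>Elements of the quotient \<open>M/N\<close> are the cosets of \<open>N\<close>.\<close>

definition quotient_module ::
  "('k, 'v) sn_module \<Rightarrow> 'v set \<Rightarrow> ('k, 'v set) sn_module" where
  "quotient_module M N =
    \<lparr>m_carrier = {{m_add M x y | y. y \<in> N} | x. x \<in> m_carrier M},
     m_add = (\<lambda>X Y. {m_add M x y | x y. x \<in> X \<and> y \<in> Y}),
     m_scale = (\<lambda>c X. {m_add M (m_scale M c x) y | x y. x \<in> X \<and> y \<in> N}),
     m_act = (\<lambda>\<sigma> X. m_act M \<sigma> ` X)\<rparr>"

definition sn_isomorphic ::
  "nat \<Rightarrow> ('k, 'v) sn_module \<Rightarrow> ('k, 'w) sn_module \<Rightarrow> bool" where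
  "sn_isomorphic n M M' \<longleftrightarrow> (\<exists>h. bij_betw h (m_carrier M) (m_carrier M') \<and>
     (\<forall>x \<in> m_carrier M. \<forall>y \<in> m_carrier M. h (m_add M x y) = m_add M' (h x) (h y)) \<and>
     (\<forall>c. \<forall>x \<in> m_carrier M. h (m_scale M c x) = m_scale M' c (h x)) \<and>
     (\<forall>\<sigma>. \<sigma> permutes {1..n} \<longrightarrow> (\<forall>x \<in> m_carrier M. h (m_act M \<sigma> x) = m_act M' \<sigma> (h x))))"

definition is_submodule ::
  "nat \<Rightarrow> (tabloid \<Rightarrow> 'a::field) set \<Rightarrow> (tabloid \<Rightarrow> 'a) set \<Rightarrow> bool" where
  "is_submodule n N V \<longleftrightarrow> N \<subseteq> V \<and> tab.subspace N \<and>
     (\<forall>\<sigma>. \<sigma> permutes {1..n} \<longrightarrow> (\<forall>f \<in> N. act \<sigma> f \<in> N))"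

text \<open>\<open>V\<close> has a filtration by submodules with successive factors \<open>Ws\<close>, from bottom to top.\<close>

definition has_filtration ::
  "nat \<Rightarrow> (tabloid \<Rightarrow> 'a::field) set \<Rightarrow> (tabloid \<Rightarrow> 'a) set list \<Rightarrow> bool" where
  "has_filtration n V Ws \<longleftrightarrow> (\<exists>N.
     N 0 = {0} \<and> N (length Ws) = V \<and>
     (\<forall>i \<le> length Ws. is_submodule n (N i) V) \<and>
     (\<forall>i < length Ws. N i \<subseteq> N (Suc i) \<and>
        sn_isomorphic n (quotient_module (tab_module (N (Suc i))) (N i)) (tab_module (Ws ! i))))"

end

theory Submission
  imports Defs
begin

text \<open>
  Put \<open>a = n - r\<close> and let \<open>M\<^sub>j\<close> be the space of functions on the \<open>j\<close>-subsets of \<open>X = {1..n}\<close>, so that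
  \<open>M\<^sub>j\<close> is the permutation module of \<open>(n - j, j)\<close>. Let \<open>d : M\<^sub>j \<rightarrow> M\<^bsub>j+1\<^esub>\<close> sum over all supersets with
  one more element. In characteristic 2 this makes \<open>M\<close> an exact complex, \<open>d\<close> is the map \<open>\<Theta>\<close> between the
  two-row modules, and, recording a hook tabloid by its first row, the Specht module of
  \<open>(n - r, 1\<^sup>r)\<close> becomes \<open>d M\<^bsub>a-1\<^esub>\<close>.

  For \<open>f \<in> M\<^sub>j\<close> let \<open>Z f C\<close> be the sum of \<open>f\<close> over the supersets of \<open>C\<close>, and let \<open>K\<^sub>i\<close> consist of the
  \<open>f \<in> M\<^bsub>a-1\<^esub>\<close> with \<open>Z f C = 0\<close> whenever \<open>card C < i\<close>. By the kernel intersection theorem, restricting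
  \<open>Z f\<close> to \<open>i\<close>-subsets induces an isomorphism from \<open>K\<^sub>i / K\<^bsub>i+1\<^esub>\<close> to the Specht module of \<open>(n - i, i)\<close>. Since \<open>n\<close> is
  even, \<open>Z (d f) C = d (Z f) C + (j + card C) Z f C\<close> for \<open>f \<in> M\<^sub>j\<close>. From this, \<open>d\<close> maps \<open>K\<^sub>i\<close> and
  \<open>K\<^bsub>i+1\<^esub>\<close> to the same space if \<open>a - 1 - i\<close> is even and positive, and \<open>d K\<^sub>i / d K\<^bsub>i+1\<^esub>\<close> is the full factor
  \<open>K\<^sub>i / K\<^bsub>i+1\<^esub>\<close> if \<open>a - 1 - i\<close> is odd. The bottom term is \<open>d K\<^bsub>a-1\<^esub>\<close>, the image of
  the Specht module of \<open>(r + 1, a - 1)\<close> under \<open>\<Theta>\<close>.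
\<close>

section \<open>The superset complex\<close>

text \<open>\<open>scale\<close> is tied to functions on tabloids. The argument takes place on
  functions on subsets, which need a vector space structure of their own; \<open>embed\<close> links
  the two.\<close>

definition fscale :: "'a::field \<Rightarrow> ('b \<Rightarrow> 'a) \<Rightarrow> 'b \<Rightarrow> 'a" where
  "fscale c f = (\<lambda>x. c * f x)"

global_interpretation fvec: vector_space fscale
  by standard (auto simp: fscale_def fun_eq_iff algebra_simps)

text \<open>The degree is a support condition on functions of all sets, so every M_j lives in one
  type and \<open>upsum\<close> and \<open>raise\<close> need no degree parameter.\<close>

definition homog :: "'b set \<Rightarrow> nat \<Rightarrow> ('b set \<Rightarrow> 'a::field) set" where
  "homog X j = {f. \<forall>A. f A \<noteq> 0 \<longrightarrow> A \<subseteq> X \<and> card A = j}"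

definition upsum :: "'b set \<Rightarrow> ('b set \<Rightarrow> 'a::field) \<Rightarrow> 'b set \<Rightarrow> 'a" where
  "upsum X f C = (\<Sum>A | A \<subseteq> X \<and> C \<subseteq> A. f A)"

text \<open>Deleting one point, instead of summing over subsets of a fixed size, makes the formula
  meaningful in all degrees at once. This is needed because \<open>raise\<close> is also applied to
  \<open>upsum X f\<close>, which is not homogeneous.\<close>

definition raise :: "'b set \<Rightarrow> ('b set \<Rightarrow> 'a::field) \<Rightarrow> 'b set \<Rightarrow> 'a" where
  "raise X f A = (if A \<subseteq> X then \<Sum>x\<in>A. f (A - {x}) else 0)"

definition kern :: "'b set \<Rightarrow> nat \<Rightarrow> nat \<Rightarrow> ('b set \<Rightarrow> 'a::field) set" where
  "kern X j i = {f \<in> homog X j. \<forall>C. C \<subseteq> X \<longrightarrow> card C < i \<longrightarrow> upsum X f C = 0}"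

definition act_set :: "('b \<Rightarrow> 'b) \<Rightarrow> ('b set \<Rightarrow> 'a::field) \<Rightarrow> 'b set \<Rightarrow> 'a" where
  "act_set \<sigma> f = (\<lambda>A. f (inv \<sigma> ` A))"

section \<open>Linearity of the superset sum and of the differential\<close>

lemma subspace_homog: "fvec.subspace (homog X j)"
  unfolding fvec.subspace_def
proof (intro conjI ballI allI)
  show "f + g \<in> homog X j" if "f \<in> homog X j" "g \<in> homog X j" for f g
    unfolding homog_def
  proof (clarify)
    fix A assume "(f + g) A \<noteq> 0"
    then have "f A \<noteq> 0 \<or> g A \<noteq> 0" by auto
    then show "A \<subseteq> X \<and> card A = j" using that by (auto simp: homog_def)
  qed
qed (simp_all add: homog_def fscale_def)

lemma upsum_add: "upsum X (f + g) C = upsum X f C + upsum X g C"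
  by (simp add: upsum_def sum.distrib)

lemma upsum_diff: "upsum X (f - g) C = upsum X f C - upsum X g C"
  by (simp add: upsum_def sum_subtractf)

lemma upsum_scale: "upsum X (fscale c f) C = c * upsum X f C"
  by (simp add: upsum_def fscale_def sum_distrib_left)

lemma upsum_zero: "upsum X 0 C = 0"
  by (simp add: upsum_def)

lemma raise_add: "raise X (f + g) = raise X f + raise X g"
  by (auto simp: raise_def sum.distrib)

lemma raise_diff: "raise X (f - g) = raise X f - raise X g"
  by (auto simp: raise_def sum_subtractf)

lemma raise_scale: "raise X (fscale c f) = fscale c (raise X f)"
  by (auto simp: raise_def fscale_def sum_distrib_left)

lemma subspace_kern: "fvec.subspace (kern X j i)"
  using subspace_homog[of X j] unfolding fvec.subspace_def kern_def
  by (auto simp: upsum_add upsum_scale upsum_zero)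

lemma kern_mono: "i \<le> i' \<Longrightarrow> kern X j i' \<subseteq> kern X j i"
  by (auto simp: kern_def)

lemma kern_0: "kern X j 0 = homog X j"
  by (auto simp: kern_def)

lemma raise_homog:
  assumes "finite X" "f \<in> homog X j"
  shows "raise X f \<in> homog X (Suc j)"
  unfolding homog_def
proof (intro CollectI allI impI)
  fix A assume "raise X f A \<noteq> 0"
  then have A: "A \<subseteq> X" and s: "(\<Sum>x\<in>A. f (A - {x})) \<noteq> 0"
    by (auto simp: raise_def split: if_splits)
  from s obtain x where x: "x \<in> A" "f (A - {x}) \<noteq> 0"
    by (meson sum.not_neutral_contains_not_neutral)
  then have "card (A - {x}) = j" using assms(2) by (auto simp: homog_def)
  with x A assms(1) show "A \<subseteq> X \<and> card A = Suc j"
    using card_Suc_Diff1[of A x] finite_subset[OF A] by simp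
qed

lemma sum_raise_swap:
  assumes "finite X" "C \<subseteq> X"
  shows "(\<Sum>A | A \<subseteq> X \<and> C \<subseteq> A. raise X f A) =
    (\<Sum>x\<in>X. \<Sum>B | B \<subseteq> X \<and> C - {x} \<subseteq> B \<and> x \<notin> B. f B)"
proof -
  have fin: "finite {A. A \<subseteq> X \<and> P A}" for P using assms by simp
  have "(\<Sum>A | A \<subseteq> X \<and> C \<subseteq> A. raise X f A) =
      (\<Sum>A | A \<subseteq> X \<and> C \<subseteq> A. \<Sum>x | x \<in> X \<and> x \<in> A. f (A - {x}))"
    by (intro sum.cong) (auto simp: raise_def intro!: sum.cong)
  also have "\<dots> = (\<Sum>x\<in>X. \<Sum>A | A \<in> {A. A \<subseteq> X \<and> C \<subseteq> A} \<and> x \<in> A. f (A - {x}))"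
    by (rule sum.swap_restrict) (use assms in auto)
  also have "\<dots> = (\<Sum>x\<in>X. \<Sum>B | B \<subseteq> X \<and> C - {x} \<subseteq> B \<and> x \<notin> B. f B)"
  proof (rule sum.cong[OF refl])
    fix x assume "x \<in> X"
    then show "(\<Sum>A | A \<in> {A. A \<subseteq> X \<and> C \<subseteq> A} \<and> x \<in> A. f (A - {x})) =
        (\<Sum>B | B \<subseteq> X \<and> C - {x} \<subseteq> B \<and> x \<notin> B. f B)"
      by (intro sum.reindex_bij_witness[where i = "insert x" and j = "\<lambda>A. A - {x}"]) auto
  qed
  finally show ?thesis .
qed

text \<open>After interchanging sums, each point \<open>x\<close> contributes the sum of
  \<open>f\<close> over the supersets of \<open>C - {x}\<close> avoiding \<open>x\<close>, which is
  Z (C - {x}) - Z (insert x C). The points of \<open>C\<close> give the \<open>raise\<close> term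
  and copies of Z C. For the points outside \<open>C\<close>, the terms Z (insert x C) count each
  superset B of \<open>C\<close> once for every point of B - C, that is \<open>j - card C\<close>
  times.\<close>

lemma upsum_raise:
  assumes X: "finite X" and C: "C \<subseteq> X" and f: "f \<in> homog X j"
  shows "upsum X (raise X f) C =
    raise X (upsum X f) C + (of_nat (card X) - of_nat j - of_nat (card C)) * upsum X f C"
proof -
  let ?Z = "upsum X f"
  have fC: "finite C" using X C finite_subset by blast
  have g: "(\<Sum>B | B \<subseteq> X \<and> C - {x} \<subseteq> B \<and> x \<notin> B. f B) = ?Z (C - {x}) - ?Z (insert x C)" for x
  proof -
    have "?Z (C - {x}) = (\<Sum>B\<in>{B. B \<subseteq> X \<and> C - {x} \<subseteq> B \<and> x \<notin> B} \<union>
         {B. B \<subseteq> X \<and> insert x C \<subseteq> B}. f B)"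
      unfolding upsum_def by (intro sum.cong) auto
    also have "\<dots> = (\<Sum>B | B \<subseteq> X \<and> C - {x} \<subseteq> B \<and> x \<notin> B. f B) + ?Z (insert x C)"
      unfolding upsum_def using X by (intro sum.union_disjoint) auto
    finally show ?thesis by simp
  qed
  have up: "(\<Sum>x\<in>X - C. ?Z (insert x C)) = (of_nat j - of_nat (card C)) * ?Z C"
  proof -
    have "(\<Sum>x\<in>X - C. ?Z (insert x C)) =
        (\<Sum>x\<in>X - C. \<Sum>B | B \<in> {B. B \<subseteq> X \<and> C \<subseteq> B} \<and> x \<in> B. f B)"
      unfolding upsum_def by (intro sum.cong) auto
    also have "\<dots> = (\<Sum>B | B \<subseteq> X \<and> C \<subseteq> B. \<Sum>x | x \<in> X - C \<and> x \<in> B. f B)"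
      by (rule sum.swap_restrict[symmetric]) (use X in auto)
    also have "\<dots> = (\<Sum>B | B \<subseteq> X \<and> C \<subseteq> B. (of_nat j - of_nat (card C)) * f B)"
    proof (rule sum.cong[OF refl], clarify)
      fix B assume B: "B \<subseteq> X" "C \<subseteq> B"
      have "{x. x \<in> X - C \<and> x \<in> B} = B - C" using B by auto
      then have "(\<Sum>x | x \<in> X - C \<and> x \<in> B. f B) = of_nat (card B - card C) * f B"
        using B fC by (simp add: card_Diff_subset)
      also have "\<dots> = (of_nat j - of_nat (card C)) * f B"
      proof (cases "f B = 0")
        case False
        then have "card B = j" using f by (auto simp: homog_def)
        moreover have "card C \<le> card B" using B X by (meson card_mono finite_subset)
        ultimately show ?thesis by (simp add: of_nat_diff)
      qed simp
      finally show "(\<Sum>x | x \<in> X - C \<and> x \<in> B. f B) = (of_nat j - of_nat (card C)) * f B" .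
    qed
    finally show ?thesis by (simp add: upsum_def sum_distrib_left)
  qed
  have "upsum X (raise X f) C = (\<Sum>x\<in>X. ?Z (C - {x}) - ?Z (insert x C))"
    unfolding upsum_def[of X "raise X f"] sum_raise_swap[OF X C] g ..
  also have "\<dots> = (\<Sum>x\<in>X - C. ?Z (C - {x}) - ?Z (insert x C)) + (\<Sum>x\<in>C. ?Z (C - {x}) - ?Z (insert x C))"
    by (rule sum.subset_diff[OF C X])
  also have "(\<Sum>x\<in>C. ?Z (C - {x}) - ?Z (insert x C)) = raise X ?Z C - of_nat (card C) * ?Z C"
    using C by (simp add: sum_subtractf raise_def insert_absorb)
  also have "(\<Sum>x\<in>X - C. ?Z (C - {x}) - ?Z (insert x C)) =
      of_nat (card X - card C) * ?Z C - (of_nat j - of_nat (card C)) * ?Z C"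
    using fC C by (simp add: sum_subtractf up card_Diff_subset)
  finally show ?thesis
    using C X by (simp add: of_nat_diff card_mono algebra_simps)
qed

section \<open>Characteristic 2: the commutation formula and exactness of the complex\<close>

lemma CHAR_2_add_self:
  assumes "CHAR('a::field) = 2"
  shows "(x::'a) + x = 0"
  using minus_CHAR_2[OF assms, of x x] by simp

lemma CHAR_2_of_nat:
  assumes "CHAR('a::field) = 2"
  shows "(of_nat m :: 'a) = (if even m then 0 else 1)"
proof (cases "even m")
  case True
  then show ?thesis using of_nat_eq_0_iff_char_dvd[where 'a = 'a, of m] assms by simp
next
  case False
  then obtain k where k: "m = Suc (2 * k)" by (metis oddE Suc_eq_plus1)
  have "(of_nat (2 * k) :: 'a) = 0"
    using of_nat_eq_0_iff_char_dvd[where 'a = 'a, of "2 * k"] assms by simp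
  then show ?thesis unfolding k of_nat_Suc using False k by simp
qed

text \<open>As \<open>card X\<close> is even, the coefficient in \<open>upsum_raise\<close> is just
  the parity of \<open>j + card C\<close>. All later case distinctions between even and odd come
  from here.\<close>

lemma upsum_raise_CHAR_2:
  fixes f :: "'b set \<Rightarrow> 'a::field"
  assumes "CHAR('a) = 2" "finite X" "even (card X)" "C \<subseteq> X" "f \<in> homog X j"
  shows "upsum X (raise X f) C =
    raise X (upsum X f) C + (if even (j + card C) then 0 else upsum X f C)"
  using upsum_raise[OF assms(2,4,5)] assms(1,3)
    CHAR_2_add_self[OF assms(1), of 1]
  by (simp add: minus_CHAR_2 CHAR_2_of_nat uminus_CHAR_2)

text \<open>Every pair of points is deleted in two orders with the same result, so the terms cancel
  in pairs.\<close>

lemma raise_raise: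
  fixes f :: "'b set \<Rightarrow> 'a::field"
  assumes char: "CHAR('a) = 2" and X: "finite X"
  shows "raise X (raise X f) = 0"
proof
  fix A
  show "raise X (raise X f) A = 0 A"
  proof (cases "A \<subseteq> X")
    case True
    then have fA: "finite A" using X finite_subset by blast
    \<comment> \<open>The value 0 on the diagonal turns the sum over ordered pairs of distinct
      points into a sum over a full square of a symmetric function. In the induction below only the
      index set grows, while \<open>A\<close> inside \<open>?g\<close> stays fixed; a new point adds
      a row and an equal column.\<close>
    let ?g = "\<lambda>x y. if y = x then 0 else f (A - {x} - {y})"
    have "raise X (raise X f) A = (\<Sum>x\<in>A. \<Sum>y\<in>A. ?g x y)"
    proof -
      have "raise X f (A - {x}) = (\<Sum>y\<in>A. ?g x y)" if "x \<in> A" for x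
      proof -
        have "raise X f (A - {x}) = (\<Sum>y\<in>A - {x}. ?g x y)"
          using True by (auto simp: raise_def intro!: sum.cong)
        then show ?thesis using that fA by (simp add: sum.remove[of A x])
      qed
      then show ?thesis
        unfolding raise_def[of X "raise X f"] using True by (simp cong: sum.cong)
    qed
    moreover have "(\<Sum>x\<in>B. \<Sum>y\<in>B. ?g x y) = 0" if "finite B" for B
      using that
    proof (induction B)
      case (insert z B)
      have "(\<Sum>x\<in>B. ?g x z) = (\<Sum>y\<in>B. ?g z y)"
        by (intro sum.cong) (auto simp: Diff_insert2[symmetric] insert_commute)
      then show ?case
        using insert CHAR_2_add_self[OF char] by (simp add: sum.distrib)
    qed simp
    ultimately show ?thesis using fA by simp
  qed (simp add: raise_def)
qed

text \<open>The contracting homotopy removes a fixed point \<open>p\<close>.\<close>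

lemma raise_exact:
  fixes f :: "'b set \<Rightarrow> 'a::field"
  assumes char: "CHAR('a) = 2" and X: "finite X" "X \<noteq> {}"
    and f: "f \<in> homog X j" "raise X f = 0"
  obtains u where "u \<in> homog X (j - 1)" "raise X u = f"
proof -
  obtain p where p: "p \<in> X" using X by blast
  define u where "u B = (if p \<notin> B \<and> B \<subseteq> X then f (insert p B) else 0)" for B
  \<comment> \<open>For \<open>j = 0\<close> the truncated degree is harmless: \<open>f\<close>
    vanishes on every finite set containing \<open>p\<close>, so \<open>u\<close> is zero.\<close>
  have "u \<in> homog X (j - 1)"
    unfolding homog_def
  proof (intro CollectI allI impI)
    fix B assume "u B \<noteq> 0"
    then have B: "p \<notin> B" "B \<subseteq> X" "f (insert p B) \<noteq> 0" by (auto simp: u_def split: if_splits)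
    then have "card (insert p B) = j" using f by (auto simp: homog_def)
    then show "B \<subseteq> X \<and> card B = j - 1"
      using B X finite_subset[of B X] by auto
  qed
  moreover have "raise X u A = f A" for A
  proof (cases "A \<subseteq> X")
    case A: True
    then have fA: "finite A" using X finite_subset by blast
    show ?thesis
    proof (cases "p \<in> A")
      case True
      then have "raise X u A = (\<Sum>x\<in>{p}. u (A - {x}))"
        using A fA unfolding raise_def by (simp add: sum.mono_neutral_right[of A "{p}"] u_def)
      then show ?thesis using True A by (auto simp: u_def insert_absorb)
    next
      case False
      \<comment> \<open>The closedness of \<open>f\<close> is evaluated at
        \<open>insert p A\<close>: deleting \<open>p\<close> gives \<open>f A\<close>, and deleting
        any other point gives a value of \<open>u\<close>.\<close>
      have "raise X f (insert p A) = f A + (\<Sum>x\<in>A. f (insert p A - {x}))"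
        using A p False fA by (simp add: raise_def)
      also have "(\<Sum>x\<in>A. f (insert p A - {x})) = raise X u A"
        using A False by (auto simp: raise_def u_def insert_Diff_if intro!: sum.cong)
      finally have "f A + raise X u A = 0" using f by simp
      then have "raise X u A = - f A" by (simp add: add_eq_0_iff)
      then show ?thesis using uminus_CHAR_2[OF char] by simp
    qed
  next
    case False
    then show ?thesis using f by (auto simp: raise_def homog_def)
  qed
  ultimately show ?thesis using that by blast
qed

section \<open>Polytabloids as transversals of columns\<close>

text \<open>The cells, as (row, column), in the columns of length two of a two-row diagram whose
  second row has length \<open>i\<close>.\<close>

definition pairs :: "nat \<Rightarrow> (nat \<times> nat) set" where
  "pairs i = {0, 1} \<times> {..<i}"

text \<open>These sets, with exactly one entry from each two-entry column, are the second rows of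
  the tabloids occurring in a polytabloid.\<close>

definition transversal :: "nat \<Rightarrow> (nat \<times> nat \<Rightarrow> 'b) \<Rightarrow> 'b set \<Rightarrow> bool" where
  "transversal i t A \<longleftrightarrow> A \<subseteq> t ` pairs i \<and> (\<forall>j<i. (t (0, j) \<in> A) \<noteq> (t (1, j) \<in> A))"

text \<open>For \<open>D = {}\<close> this is the polytabloid of \<open>t\<close> in characteristic
  2, with tabloids recorded by their second rows. A nonempty \<open>D\<close>, disjoint from the
  columns, raises the degree by \<open>card D\<close>.\<close>

definition transversals :: "nat \<Rightarrow> (nat \<times> nat \<Rightarrow> 'b) \<Rightarrow> 'b set \<Rightarrow> 'b set \<Rightarrow> 'a::field" where
  "transversals i t D A = of_bool (D \<subseteq> A \<and> transversal i t (A - D))"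

text \<open>Only the two-entry columns of a tableau influence its polytabloid, so just these are
  filled. The ground set can then be arbitrary, which permits induction on it.\<close>

definition polys :: "'b set \<Rightarrow> nat \<Rightarrow> ('b set \<Rightarrow> 'a::field) set" where
  "polys X i = {transversals i t {} | t. inj_on t (pairs i) \<and> t ` pairs i \<subseteq> X}"

text \<open>Choosing one element of \<open>C\<close> in each column gives \<open>i\<close> distinct
  elements. If \<open>C\<close> has no others, it cannot contain both entries of a column.\<close>

lemma transversal_if_meets_columns:
  assumes t: "inj_on t (pairs i)" and "finite C"
    and meets: "\<And>j. j < i \<Longrightarrow> t (0, j) \<in> C \<or> t (1, j) \<in> C"
  shows "i \<le> card C" "card C = i \<Longrightarrow> transversal i t C"
proof -
  define c where "c j = (if t (0, j) \<in> C then (0::nat) else 1)" for j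
  let ?c = "\<lambda>j. t (c j, j)"
  have cC: "?c ` {..<i} \<subseteq> C" using meets by (force simp: c_def)
  have inj: "inj_on ?c {..<i}"
  proof (rule inj_onI)
    fix j k assume "j \<in> {..<i}" "k \<in> {..<i}" "?c j = ?c k"
    then have "(c j, j) = (c k, k)"
      using inj_onD[OF t, of "(c j, j)" "(c k, k)"] by (auto simp: pairs_def c_def)
    then show "j = k" by simp
  qed
  show "i \<le> card C"
    using card_mono[OF \<open>finite C\<close> cC] card_image[OF inj] by simp
  assume "card C = i"
  then have C: "?c ` {..<i} = C"
    using card_subset_eq[OF \<open>finite C\<close> cC] card_image[OF inj] by simp
  \<comment> \<open>\<open>c\<close> prefers row 0, so if both entries were in \<open>C\<close>, the
    lower one would be an element of \<open>C\<close> that was not chosen.\<close>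
  have "\<not> (t (0, j) \<in> C \<and> t (1, j) \<in> C)" if "j < i" for j
  proof
    assume *: "t (0, j) \<in> C \<and> t (1, j) \<in> C"
    then obtain k where k: "k < i" "t (1, j) = ?c k" using C by blast
    then have "(1, j) = (c k, k)"
      using inj_onD[OF t, of "(1, j)" "(c k, k)"] that by (auto simp: pairs_def c_def)
    then show False using * by (auto simp: c_def)
  qed
  moreover have "C \<subseteq> t ` pairs i" unfolding C[symmetric] by (auto simp: pairs_def c_def)
  ultimately show "transversal i t C" using meets by (auto simp: transversal_def)
qed

lemma card_transversal:
  assumes t: "inj_on t (pairs i)" and A: "transversal i t A"
  shows "card A = i"
proof -
  define c where "c j = (if t (0, j) \<in> A then (0::nat) else 1)" for j
  have "A = (\<lambda>j. t (c j, j)) ` {..<i}"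
    using A by (fastforce simp: transversal_def c_def pairs_def)
  moreover have "inj_on (\<lambda>j. t (c j, j)) {..<i}"
  proof (rule inj_onI)
    fix j k assume "j \<in> {..<i}" "k \<in> {..<i}" "t (c j, j) = t (c k, k)"
    then have "(c j, j) = (c k, k)"
      using inj_onD[OF t, of "(c j, j)" "(c k, k)"] by (auto simp: pairs_def c_def)
    then show "j = k" by simp
  qed
  ultimately show ?thesis by (metis card_image card_lessThan)
qed

lemma card_pairs: "card (pairs i) = 2 * i"
  by (simp add: pairs_def card_cartesian_product)

lemma finite_pairs: "finite (pairs i)"
  by (simp add: pairs_def)

lemma homog_transversals:
  assumes t: "inj_on t (pairs i)" "t ` pairs i \<subseteq> X" and D: "finite D" "D \<subseteq> X"
  shows "transversals i t D \<in> homog X (i + card D)"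
  unfolding homog_def
proof (intro CollectI allI impI)
  fix A assume "transversals i t D A \<noteq> (0::'b)"
  then have A: "D \<subseteq> A" "transversal i t (A - D)" by (auto simp: transversals_def)
  have sub: "A - D \<subseteq> t ` pairs i" using A by (auto simp: transversal_def)
  then have "finite (A - D)" using finite_pairs finite_surj by blast
  then have "card A = card (A - D) + card D"
    using A D by (metis card_Un_disjoint Diff_disjoint Diff_partition Int_commute add.commute)
  then show "A \<subseteq> X \<and> card A = i + card D"
    using card_transversal[OF t(1) A(2)] sub t(2) D A by auto
qed

text \<open>If \<open>C\<close> misses a column, exchanging the two entries of that column pairs off the summands.\<close>

lemma upsum_transversals_eq_0:
  assumes char: "CHAR('a::field) = 2" and X: "finite X"
    and t: "inj_on t (pairs i)" "t ` pairs i \<subseteq> X" and D: "D \<inter> t ` pairs i = {}"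
    and j: "j < i" "t (0, j) \<notin> C" "t (1, j) \<notin> C"
  shows "upsum X (transversals i t D) C = (0::'a)"
proof -
  let ?a = "t (0, j)" and ?b = "t (1, j)"
  have ab: "?a \<noteq> ?b" "?a \<in> X" "?b \<in> X" "?a \<in> t ` pairs i" "?b \<in> t ` pairs i"
    using inj_onD[OF t(1), of "(0, j)" "(1, j)"] j t(2) by (auto simp: pairs_def)
  have other: "t (u, k) \<noteq> ?a" "t (u, k) \<noteq> ?b" if "k < i" "k \<noteq> j" "u \<in> {0, 1}" for k u
    using inj_onD[OF t(1), of "(u, k)" "(0, j)"] inj_onD[OF t(1), of "(u, k)" "(1, j)"] that j
    by (auto simp: pairs_def)
  let ?P = "\<lambda>A. A \<subseteq> X \<and> C \<subseteq> A \<and> D \<subseteq> A \<and> transversal i t (A - D)"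
  let ?e = "\<lambda>A a b. insert b (A - {a})"
  have e: "?P (?e A a b)" "?e (?e A a b) b a = A"
    if "?P A" "a \<in> A" "{a, b} = {?a, ?b}" for A a b
  proof -
    have ab': "a \<noteq> b" "a \<notin> D" "b \<notin> D" "a \<notin> C" "b \<notin> C" "b \<in> X" "b \<in> t ` pairs i"
      using that(3) ab j D by (auto simp: doubleton_eq_iff)
    have bA: "b \<notin> A" using that ab' j ab
      by (auto simp: transversal_def doubleton_eq_iff)
    have eq: "?e A a b - D = ?e (A - D) a b" using ab' by auto
    have "transversal i t (?e (A - D) a b)"
      unfolding transversal_def
    proof (intro conjI allI impI)
      show "?e (A - D) a b \<subseteq> t ` pairs i" using that ab' by (auto simp: transversal_def)
      fix k assume k: "k < i"
      show "(t (0, k) \<in> ?e (A - D) a b) \<noteq> (t (1, k) \<in> ?e (A - D) a b)"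
      proof (cases "k = j")
        case True
        then show ?thesis using that(3) ab' bA by (auto simp: doubleton_eq_iff)
      next
        case False
        then show ?thesis using other[OF k False] that(1,3) k
          by (auto simp: transversal_def doubleton_eq_iff)
      qed
    qed
    then show "?P (?e A a b)" using that ab' eq by auto
    show "?e (?e A a b) b a = A" using that bA by auto
  qed
  have one: "(?a \<in> A) \<noteq> (?b \<in> A)" if "?P A" for A
  proof -
    have "?a \<notin> D" "?b \<notin> D" using D ab by auto
    then show ?thesis using that j unfolding transversal_def by blast
  qed
  have "{A. ?P A} = {A. ?P A \<and> ?a \<in> A} \<union> {A. ?P A \<and> ?b \<in> A}"
    using one by blast
  moreover have "{A. ?P A \<and> ?a \<in> A} \<inter> {A. ?P A \<and> ?b \<in> A} = {}"
    using one by blast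
  moreover have "card {A. ?P A \<and> ?a \<in> A} = card {A. ?P A \<and> ?b \<in> A}"
    using e j(2,3) by (intro bij_betw_same_card[of "\<lambda>A. ?e A ?a ?b"]
      bij_betw_byWitness[where f' = "\<lambda>A. ?e A ?b ?a"]) (auto simp: insert_commute)
  moreover have "finite {A. ?P A}" using X by simp
  ultimately have "card {A. ?P A} = 2 * card {A. ?P A \<and> ?a \<in> A}"
    by (metis (no_types, lifting) card_Un_disjoint finite_Un mult_2)
  moreover have "upsum X (transversals i t D) C = (of_nat (card {A. ?P A}) :: 'a)"
  proof -
    have "upsum X (transversals i t D) C = (\<Sum>A | ?P A. (1::'a))"
      unfolding upsum_def transversals_def using X
      by (intro sum.mono_neutral_cong_right) auto
    then show ?thesis by simp
  qed
  ultimately show ?thesis using CHAR_2_of_nat[OF char] by simp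
qed

text \<open>A set with fewer than \<open>i\<close> elements misses one of the \<open>i\<close>
  columns.\<close>

lemma upsum_transversals_less:
  assumes char: "CHAR('a::field) = 2" and X: "finite X"
    and t: "inj_on t (pairs i)" "t ` pairs i \<subseteq> X" and D: "D \<inter> t ` pairs i = {}"
    and C: "C \<subseteq> X" "card C < i"
  shows "upsum X (transversals i t D) C = (0::'a)"
proof -
  have "finite C" using X C finite_subset by blast
  then have "\<exists>j<i. t (0, j) \<notin> C \<and> t (1, j) \<notin> C"
    using transversal_if_meets_columns(1)[OF t(1)] C(2) by (meson not_le)
  then show ?thesis using upsum_transversals_eq_0[OF char X t D] by blast
qed

text \<open>If \<open>C\<close> misses a column, both sides vanish. Otherwise \<open>C\<close> is a
  transversal, and by cardinality \<open>C \<union> D\<close> is the only set in the sum.\<close>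

lemma upsum_transversals_eq:
  assumes char: "CHAR('a::field) = 2" and X: "finite X"
    and t: "inj_on t (pairs i)" "t ` pairs i \<subseteq> X" and D: "D \<inter> t ` pairs i = {}" "D \<subseteq> X"
    and C: "C \<subseteq> X" "card C = i"
  shows "upsum X (transversals i t D) C = (transversals i t {} C :: 'a)"
proof -
  have fC: "finite C" using X C finite_subset by blast
  show ?thesis
  proof (cases "\<exists>j<i. t (0, j) \<notin> C \<and> t (1, j) \<notin> C")
    case True
    then show ?thesis using upsum_transversals_eq_0[OF char X t D(1)]
      by (auto simp: transversals_def transversal_def)
  next
    case False
    then have tC: "transversal i t C"
      using transversal_if_meets_columns(2)[OF t(1) fC] C(2) by blast
    then have CD: "C \<inter> D = {}" using D by (auto simp: transversal_def)
    have "A = C \<union> D" if "A \<subseteq> X" "C \<subseteq> A" "D \<subseteq> A" "transversal i t (A - D)" for A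
    proof -
      have "C \<subseteq> A - D" using that CD by auto
      moreover have "finite (A - D)" using that X finite_subset by blast
      ultimately have "C = A - D"
        using card_transversal[OF t(1) that(4)] C(2) card_subset_eq by metis
      then show ?thesis using that by auto
    qed
    moreover have "C \<union> D - D = C" using CD by auto
    ultimately have "upsum X (transversals i t D) C = (\<Sum>A\<in>{C \<union> D}. (1::'a))"
      unfolding upsum_def transversals_def using X tC D C
      by (intro sum.mono_neutral_cong_right) auto
    then show ?thesis using tC by (simp add: transversals_def)
  qed
qed

lemma transversals_in_kern:
  assumes "CHAR('a::field) = 2" "finite X" "inj_on t (pairs i)" "t ` pairs i \<subseteq> X"
    "D \<inter> t ` pairs i = {}" "D \<subseteq> X"
  shows "(transversals i t D :: _ \<Rightarrow> 'a) \<in> kern X (i + card D) i"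
  using homog_transversals[OF assms(3,4) finite_subset[OF assms(6,2)] assms(6)]
    upsum_transversals_less[OF assms(1-5)]
  by (simp add: kern_def)

section \<open>James's kernel intersection theorem for two-row partitions\<close>

text \<open>Inclusion-exclusion, one point of \<open>D\<close> at a time: the sets avoiding
  \<open>d\<close> are all sets without those containing \<open>d\<close>. Requiring
  \<open>d\<close> instead of avoiding it does not increase \<open>card C + card D\<close>.\<close>

lemma sum_avoiding_eq_0:
  assumes X: "finite X" and f: "f \<in> kern X i i" and D: "finite D" "D \<subseteq> X"
  shows "C \<subseteq> X \<Longrightarrow> card C + card D < i \<Longrightarrow> (\<Sum>A | A \<subseteq> X \<and> C \<subseteq> A \<and> A \<inter> D = {}. f A) = 0"
  using D
proof (induction D arbitrary: C)
  case empty
  then show ?case using f by (simp add: kern_def upsum_def)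
next
  case (insert d D)
  have "finite C" using insert X finite_subset by blast
  then have card: "card (insert d C) + card D < i" "card C + card D < i"
    using insert card_insert_le_m1[of "Suc (card C)" C d] by (auto simp: card_insert_if)
  let ?S = "\<lambda>D C. {A. A \<subseteq> X \<and> C \<subseteq> A \<and> A \<inter> D = {}}"
  have "(\<Sum>A\<in>?S D C. f A) = (\<Sum>A\<in>?S (insert d D) C \<union> ?S D (insert d C). f A)"
    by (intro sum.cong) auto
  also have "\<dots> = (\<Sum>A\<in>?S (insert d D) C. f A) + (\<Sum>A\<in>?S D (insert d C). f A)"
    using X by (intro sum.union_disjoint) auto
  finally show ?case
    using insert.IH[of C] insert.IH[of "insert d C"] insert.prems card by simp
qed

text \<open>If \<open>A\<close> is in the support, its complement has fewer than \<open>i\<close>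
  points. Among the sets avoiding this complement only \<open>A\<close> has size \<open>i\<close>,
  so the vanishing sum over them is \<open>f A\<close>.\<close>

lemma kern_eq_0:
  assumes X: "finite X" and f: "f \<in> kern X i i" and i: "card X < 2 * i"
  shows "f = 0"
proof (rule ccontr)
  assume "f \<noteq> 0"
  then obtain A where "f A \<noteq> 0" by fastforce
  then have A: "A \<subseteq> X" "card A = i" using f by (auto simp: kern_def homog_def)
  have "card (X - A) < i"
    using A X i by (simp add: card_Diff_subset finite_subset)
  then have "(\<Sum>B | B \<subseteq> X \<and> {} \<subseteq> B \<and> B \<inter> (X - A) = {}. f B) = 0"
    using sum_avoiding_eq_0[OF X f, of "X - A" "{}"] X by simp
  also have "(\<Sum>B | B \<subseteq> X \<and> {} \<subseteq> B \<and> B \<inter> (X - A) = {}. f B) = (\<Sum>B\<in>{A}. f B)"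
  proof (rule sum.mono_neutral_right)
    show "\<forall>B\<in>{B. B \<subseteq> X \<and> {} \<subseteq> B \<and> B \<inter> (X - A) = {}} - {A}. f B = 0"
    proof
      fix B assume "B \<in> {B. B \<subseteq> X \<and> {} \<subseteq> B \<and> B \<inter> (X - A) = {}} - {A}"
      then have "B \<subset> A" by auto
      then have "card B < i" using A X by (metis finite_subset psubset_card_mono)
      then show "f B = 0" using f by (auto simp: kern_def homog_def)
    qed
  qed (use X A in auto)
  finally show False using \<open>f A \<noteq> 0\<close> by simp
qed

text \<open>The tableau gets one more column, made of \<open>x\<close> and a point \<open>a\<close>
  outside the old columns, which exists because \<open>2 * i < card Y\<close>. A transversal through
  \<open>x\<close> omits \<open>a\<close>, and without \<open>x\<close> it is a transversal of the
  old columns.\<close>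

lemma polys_lift:
  assumes x: "x \<notin> Y" and Y: "finite Y" "2 * i < card Y" and f: "f \<in> fvec.span (polys Y i)"
  shows "\<exists>g \<in> fvec.span (polys (insert x Y) (Suc i)). \<forall>A. A \<subseteq> Y \<longrightarrow> g (insert x A) = f A"
  using f
proof (induction rule: fvec.span_induct_alt)
  case base
  show ?case by (rule bexI[of _ 0]) (simp_all add: fvec.span_zero)
next
  case (step c p h)
  from step(2) obtain h' where h': "h' \<in> fvec.span (polys (insert x Y) (Suc i))"
    "\<forall>A. A \<subseteq> Y \<longrightarrow> h' (insert x A) = h A" by blast
  from step(1) obtain t where t: "p = transversals i t {}" "inj_on t (pairs i)" "t ` pairs i \<subseteq> Y"
    by (auto simp: polys_def)
  have "card (t ` pairs i) < card Y" using Y card_image[OF t(2)] by (simp add: card_pairs)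
  then obtain a where a: "a \<in> Y" "a \<notin> t ` pairs i"
    by (metis t(3) order_less_irrefl subset_antisym subsetI)
  define t' where "t' = t((0, i) := a, (1, i) := x)"
  have pairs: "pairs (Suc i) = insert (0, i) (insert (1, i) (pairs i))"
    by (auto simp: pairs_def)
  have out: "(0, i) \<notin> pairs i" "(1, i) \<notin> pairs i" by (auto simp: pairs_def)
  have same: "t' c = t c" if "c \<in> pairs i" for c
    using that out by (auto simp: t'_def)
  have img: "t' ` pairs i = t ` pairs i" using same by force
  have inj: "inj_on t' (pairs (Suc i))"
  proof -
    have "inj_on t' (pairs i)" using t(2) same by (simp add: inj_on_def)
    moreover have "t' (0, i) = a" "t' (1, i) = x" by (simp_all add: t'_def)
    moreover have "a \<noteq> x" using a x by auto
    moreover have "a \<notin> t' ` pairs i" "x \<notin> t' ` pairs i" using a x t(3) img by auto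
    ultimately show ?thesis unfolding pairs inj_on_insert using out by (auto simp: inj_on_def)
  qed
  have sub: "t' ` pairs (Suc i) \<subseteq> insert x Y"
    unfolding pairs image_insert img using a t(3) by (auto simp: t'_def)
  have val: "transversals (Suc i) t' {} (insert x A) = p A" if A: "A \<subseteq> Y" for A
  proof -
    have "transversal (Suc i) t' (insert x A) \<longleftrightarrow> transversal i t A"
    proof -
      have *: "t (u, k) \<noteq> x" "t' (u, k) = t (u, k)" if "k < i" "u \<in> {0, 1}" for u k
        using that t(3) x by (auto simp: pairs_def t'_def)
      have "a \<notin> A \<Longrightarrow> insert x A \<subseteq> t' ` pairs (Suc i) \<longleftrightarrow> A \<subseteq> t ` pairs i"
        unfolding pairs image_insert img using A x t(3) by (auto simp: t'_def)
      moreover have "t' (0, i) = a" "t' (1, i) = x" by (simp_all add: t'_def)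
      moreover have "a \<noteq> x" using a x by auto
      ultimately show ?thesis
        unfolding transversal_def less_Suc_eq using * a by (cases "a \<in> A") auto
    qed
    then show ?thesis by (simp add: t(1) transversals_def)
  qed
  have "transversals (Suc i) t' {} \<in> polys (insert x Y) (Suc i)"
    using inj sub by (auto simp: polys_def)
  then have "fscale c (transversals (Suc i) t' {}) + h' \<in> fvec.span (polys (insert x Y) (Suc i))"
    using h'(1) by (intro fvec.span_add[OF fvec.span_scale[OF fvec.span_base]])
  moreover have "\<forall>A. A \<subseteq> Y \<longrightarrow>
      (fscale c (transversals (Suc i) t' {}) + h') (insert x A) = (fscale c p + h) A"
    using val h'(2) by (auto simp: fscale_def)
  ultimately show ?case by blast
qed

lemma span_polys_subset_kern:
  assumes "CHAR('a::field) = 2" "finite X"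
  shows "fvec.span (polys X i :: (_ \<Rightarrow> 'a) set) \<subseteq> kern X i i"
proof (rule fvec.span_minimal[OF _ subspace_kern])
  show "(polys X i :: (_ \<Rightarrow> 'a) set) \<subseteq> kern X i i"
    using transversals_in_kern[OF assms, of _ i "{}"] by (auto simp: polys_def)
qed

lemma polys_mono: "X \<subseteq> Y \<Longrightarrow> polys X i \<subseteq> polys Y i"
  by (auto simp: polys_def)

text \<open>The part of \<open>f\<close> on the sets through \<open>x\<close> loses one degree and
  one vanishing condition, because its sum over the supersets of \<open>C\<close> in
  \<open>Y\<close> is the sum of \<open>f\<close> over the supersets of
  \<open>insert x C\<close>.\<close>

lemma kern_insert:
  assumes Y: "finite Y" "x \<notin> Y" and f: "f \<in> kern (insert x Y) (Suc i) (Suc i)"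
  shows "(\<lambda>A. if A \<subseteq> Y then f (insert x A) else 0) \<in> kern Y i i" (is "?f \<in> _")
  unfolding kern_def
proof (intro CollectI conjI allI impI)
  show "?f \<in> homog Y i"
    unfolding homog_def
  proof (intro CollectI allI impI)
    fix A assume "?f A \<noteq> 0"
    then have A: "A \<subseteq> Y" "f (insert x A) \<noteq> 0" by (auto split: if_splits)
    have "card (insert x A) = Suc i" using A f by (auto simp: kern_def homog_def)
    moreover have "x \<notin> A" using A Y by auto
    ultimately show "A \<subseteq> Y \<and> card A = i" using A Y finite_subset[OF A(1)] by auto
  qed
next
  fix C assume C: "C \<subseteq> Y" "card C < i"
  have "upsum Y ?f C = (\<Sum>A | A \<subseteq> Y \<and> C \<subseteq> A. f (insert x A))"
    unfolding upsum_def by (intro sum.cong) auto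
  also have "\<dots> = upsum (insert x Y) f (insert x C)"
    unfolding upsum_def using Y C
    by (intro sum.reindex_bij_witness[where j = "insert x" and i = "\<lambda>A. A - {x}"]) auto
  also have "\<dots> = 0"
  proof -
    have "card (insert x C) < Suc i" "insert x C \<subseteq> insert x Y"
      using C Y finite_subset[OF C(1)] by (auto simp: card_insert_if)
    then show ?thesis using f unfolding kern_def by blast
  qed
  finally show "upsum Y ?f C = 0" .
qed

text \<open>Induction on the ground set. The part of \<open>f\<close> on sets through
  \<open>x\<close> is a combination of polytabloids on \<open>Y\<close>; their lifts by
  \<open>polys_lift\<close> match \<open>f\<close> on these sets, and the difference is supported on
  \<open>Y\<close>. If there is no room for a lift, \<open>kern_eq_0\<close> applies.\<close>

lemma kern_subset_span_polys:
  assumes char: "CHAR('a::field) = 2" and X: "finite X"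
  shows "(f :: _ \<Rightarrow> 'a) \<in> kern X i i \<Longrightarrow> f \<in> fvec.span (polys X i)"
  using X
proof (induction X arbitrary: i f)
  case empty
  show ?case
  proof (cases i)
    case 0
    have "transversals 0 (\<lambda>_. undefined) {} \<in> (polys {} 0 :: (_ \<Rightarrow> 'a) set)"
      by (auto simp: polys_def pairs_def)
    then have *: "fscale (f {}) (transversals 0 (\<lambda>_. undefined) {}) \<in> fvec.span (polys {} i)"
      unfolding 0 by (intro fvec.span_scale fvec.span_base)
    have eq: "f = fscale (f {}) (transversals 0 (\<lambda>_. undefined) {})"
    proof
      fix A
      show "f A = fscale (f {}) (transversals 0 (\<lambda>_. undefined) {}) A"
      proof (cases "A = {}")
        case False
        then have "f A = 0" using empty by (auto simp: kern_def homog_def)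
        with False show ?thesis by (simp add: fscale_def transversals_def transversal_def pairs_def)
      qed (simp add: fscale_def transversals_def transversal_def pairs_def)
    qed
    show ?thesis by (subst eq) (rule *)
  next
    case (Suc k)
    then have "f = 0" by (intro kern_eq_0[OF _ empty]) simp_all
    then show ?thesis by (simp only: fvec.span_zero)
  qed
next
  case (insert x Y)
  let ?X = "insert x Y"
  have finX: "finite ?X" using insert.hyps by simp
  have mono: "fvec.span (polys Y i) \<subseteq> fvec.span (polys ?X i)"
    by (intro fvec.span_mono polys_mono) auto
  show ?case
  proof (cases i)
    case 0
    \<comment> \<open>In degree 0 the only possible support is the empty set, so \<open>x\<close> is
      irrelevant.\<close>
    have "f \<in> homog Y 0"
      unfolding homog_def
    proof (intro CollectI allI impI)
      fix A assume "f A \<noteq> 0"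
      then have "A \<subseteq> ?X" "card A = 0" using insert.prems 0 by (auto simp: kern_def homog_def)
      then have "A = {}" using \<open>finite Y\<close> finite_subset[of A ?X] by simp
      then show "A \<subseteq> Y \<and> card A = 0" by simp
    qed
    then have "f \<in> fvec.span (polys Y i)" unfolding 0 by (intro insert.IH) (simp add: kern_0)
    then show ?thesis by (rule subsetD[OF mono])
  next
    case (Suc k)
    show ?thesis
    proof (cases "card ?X < 2 * i")
      case True
      then have "f = 0" by (rule kern_eq_0[OF finX insert.prems])
      then show ?thesis by (simp only: fvec.span_zero)
    next
      case False
      then have k: "2 * k < card Y" using Suc insert.hyps by simp
      let ?f = "\<lambda>A. if A \<subseteq> Y then f (insert x A) else 0"
      have "?f \<in> fvec.span (polys Y k)"
        by (rule insert.IH[OF kern_insert[OF insert.hyps insert.prems[unfolded Suc]]])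
      from polys_lift[OF insert.hyps(2,1) k this]
      obtain g where g: "g \<in> fvec.span (polys ?X i)" "\<forall>A. A \<subseteq> Y \<longrightarrow> g (insert x A) = ?f A"
        unfolding Suc by auto
      \<comment> \<open>Subtracting the lift removes all values on sets through \<open>x\<close>;
        what remains satisfies the kernel conditions on \<open>Y\<close>.\<close>
      let ?h = "f - g"
      have "g \<in> kern ?X i i" by (rule subsetD[OF span_polys_subset_kern[OF char finX] g(1)])
      then have h: "?h \<in> kern ?X i i" by (rule fvec.subspace_diff[OF subspace_kern insert.prems])
      have hx: "?h A = 0" if "A \<subseteq> ?X" "x \<in> A" for A
      proof -
        have A: "A - {x} \<subseteq> Y" "insert x (A - {x}) = A" using that by auto
        have "g (insert x (A - {x})) = f (insert x (A - {x}))" 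
          using g(2)[rule_format, OF A(1)] unfolding if_P[OF A(1)] .
        then have "g A = f A" unfolding A(2) .
        then show ?thesis by simp
      qed
      have "?h \<in> kern Y i i"
        unfolding kern_def
      proof (intro CollectI conjI allI impI)
        show "?h \<in> homog Y i"
          unfolding homog_def
        proof (intro CollectI allI impI)
          fix A assume *: "?h A \<noteq> 0"
          then have "A \<subseteq> ?X \<and> card A = i" using h by (simp add: kern_def homog_def)
          then show "A \<subseteq> Y \<and> card A = i" using * hx[of A] by blast
        qed
      next
        fix C assume C: "C \<subseteq> Y" "card C < i"
        have "upsum Y ?h C = upsum ?X ?h C"
          unfolding upsum_def using \<open>finite Y\<close> hx
          by (intro sum.mono_neutral_left) auto
        moreover have "C \<subseteq> ?X" using C by auto
        ultimately show "upsum Y ?h C = 0" using h C by (simp add: kern_def)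
      qed
      then have "?h \<in> fvec.span (polys Y i)" by (rule insert.IH)
      then have "?h \<in> fvec.span (polys ?X i)" by (rule subsetD[OF mono])
      then have "g + ?h \<in> fvec.span (polys ?X i)" by (rule fvec.span_add[OF g(1)])
      then show ?thesis by simp
    qed
  qed
qed

lemma kern_eq_span_polys:
  assumes "CHAR('a::field) = 2" "finite X"
  shows "(kern X i i :: (_ \<Rightarrow> 'a) set) = fvec.span (polys X i)"
  using kern_subset_span_polys[OF assms] span_polys_subset_kern[OF assms] by blast

section \<open>The kernel filtration and the differential\<close>

text \<open>Multiplying a polytabloid by unused entries \<open>D\<close> of the first row lifts it to degree \<open>j\<close>.\<close>

lemma kern_lift:
  fixes w :: "'b set \<Rightarrow> 'a::field"
  assumes char: "CHAR('a) = 2" and X: "finite X" and ij: "i \<le> j" "i + j \<le> card X"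
    and w: "w \<in> kern X i i"
  obtains v where "v \<in> kern X j i" "\<And>C. C \<subseteq> X \<Longrightarrow> card C = i \<Longrightarrow> upsum X v C = w C"
proof -
  have "w \<in> fvec.span (polys X i)" using w kern_eq_span_polys[OF char X] by blast
  then have "\<exists>v \<in> kern X j i. \<forall>C. C \<subseteq> X \<longrightarrow> card C = i \<longrightarrow> upsum X v C = w C"
  proof (induction rule: fvec.span_induct_alt)
    case base
    show ?case using fvec.subspace_0[OF subspace_kern] by (intro bexI[of _ 0]) (simp_all add: upsum_def)
  next
    case (step c p h)
    from step(2) obtain h' where h': "h' \<in> kern X j i"
      "\<forall>C. C \<subseteq> X \<longrightarrow> card C = i \<longrightarrow> upsum X h' C = h C" by blast
    from step(1) obtain t where t: "p = transversals i t {}" "inj_on t (pairs i)" "t ` pairs i \<subseteq> X"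
      by (auto simp: polys_def)
    have "card (X - t ` pairs i) = card X - 2 * i"
      using t X card_image[OF t(2)] finite_pairs by (simp add: card_Diff_subset card_pairs)
    \<comment> \<open>The bound \<open>i + j \<le> card X\<close> leaves enough points outside the
      columns for \<open>D\<close>.\<close>
    then have "j - i \<le> card (X - t ` pairs i)" using ij by simp
    then obtain D where D: "D \<subseteq> X - t ` pairs i" "card D = j - i"
      using obtain_subset_with_card_n by metis
    let ?v = "transversals i t D :: _ \<Rightarrow> 'a"
    have D': "D \<inter> t ` pairs i = {}" "D \<subseteq> X" using D by auto
    have "?v \<in> kern X j i"
      using transversals_in_kern[OF char X t(2,3) D'] D(2) ij by simp
    then have "fscale c ?v + h' \<in> kern X j i"
      using h'(1) by (intro fvec.subspace_add[OF subspace_kern] fvec.subspace_scale[OF subspace_kern])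
    moreover have "\<forall>C. C \<subseteq> X \<longrightarrow> card C = i \<longrightarrow> upsum X (fscale c ?v + h') C = (fscale c p + h) C"
      using upsum_transversals_eq[OF char X t(2,3) D'] h'(2)
      unfolding upsum_add upsum_scale t(1) by (simp add: fscale_def)
    ultimately show ?case by blast
  qed
  then show ?thesis using that by blast
qed

definition level :: "'b set \<Rightarrow> nat \<Rightarrow> ('b set \<Rightarrow> 'a::field) \<Rightarrow> 'b set \<Rightarrow> 'a" where
  "level X i f C = (if C \<subseteq> X \<and> card C = i then upsum X f C else 0)"

text \<open>Summing \<open>upsum X v\<close> over the \<open>i\<close>-sets that contain
  \<open>C\<close> counts each set A of size \<open>j\<close> containing \<open>C\<close> once per
  intermediate \<open>i\<close>-set. This number is a binomial coefficient depending only on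
  \<open>card C\<close>, so the result is a multiple of \<open>upsum X v C\<close>, which is
  0.\<close>

lemma level_in_kern:
  assumes X: "finite X" and v: "v \<in> kern X j i"
  shows "level X i v \<in> kern X i i"
  unfolding kern_def
proof (intro CollectI conjI allI impI)
  show "level X i v \<in> homog X i" by (auto simp: homog_def level_def)
next
  fix C assume C: "C \<subseteq> X" "card C < i"
  have fC: "finite C" using C X finite_subset by blast
  have "upsum X (level X i v) C = (\<Sum>D | D \<subseteq> X \<and> C \<subseteq> D \<and> card D = i. upsum X v D)"
    unfolding upsum_def[of X "level X i v"] using X
    by (intro sum.mono_neutral_cong_right) (auto simp: level_def)
  also have "\<dots> = (\<Sum>D | D \<subseteq> X \<and> C \<subseteq> D \<and> card D = i. \<Sum>A | A \<in> {A. A \<subseteq> X \<and> C \<subseteq> A} \<and> D \<subseteq> A. v A)"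
    unfolding upsum_def by (intro sum.cong) auto
  also have "\<dots> = (\<Sum>A | A \<subseteq> X \<and> C \<subseteq> A. \<Sum>D | D \<in> {D. D \<subseteq> X \<and> C \<subseteq> D \<and> card D = i} \<and> D \<subseteq> A. v A)"
    by (rule sum.swap_restrict) (use X in auto)
  also have "\<dots> = (\<Sum>A | A \<subseteq> X \<and> C \<subseteq> A. of_nat ((j - card C) choose (i - card C)) * v A)"
  proof (rule sum.cong[OF refl], clarify)
    fix A assume A: "A \<subseteq> X" "C \<subseteq> A"
    have fA: "finite A" using A X finite_subset by blast
    have "card {D. C \<subseteq> D \<and> D \<subseteq> A \<and> card D = i} = card {E. E \<subseteq> A - C \<and> card E = i - card C}"
    proof (intro bij_betw_same_card[of "\<lambda>D. D - C"] bij_betw_byWitness[where f' = "\<lambda>E. E \<union> C"])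
      show "(\<lambda>E. E \<union> C) ` {E. E \<subseteq> A - C \<and> card E = i - card C} \<subseteq> {D. C \<subseteq> D \<and> D \<subseteq> A \<and> card D = i}"
      proof clarify
        fix E assume E: "E \<subseteq> A - C" "card E = i - card C"
        then have "finite E" "E \<inter> C = {}" using fA finite_subset by blast+
        then show "C \<subseteq> E \<union> C \<and> E \<union> C \<subseteq> A \<and> card (E \<union> C) = i"
          using E A fC C(2) by (auto simp: card_Un_disjoint)
      qed
    qed (use fC in \<open>auto simp: card_Diff_subset\<close>)
    also have "\<dots> = (card A - card C) choose (i - card C)"
      using fA fC A by (simp add: n_subsets card_Diff_subset)
    finally have "card {D. C \<subseteq> D \<and> D \<subseteq> A \<and> card D = i} = (card A - card C) choose (i - card C)" .
    moreover have "{D. D \<in> {D. D \<subseteq> X \<and> C \<subseteq> D \<and> card D = i} \<and> D \<subseteq> A} = {D. C \<subseteq> D \<and> D \<subseteq> A \<and> card D = i}"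
      using A by auto
    moreover have "v A = 0 \<or> card A = j" using v by (auto simp: kern_def homog_def)
    ultimately show "(\<Sum>D | D \<in> {D. D \<subseteq> X \<and> C \<subseteq> D \<and> card D = i} \<and> D \<subseteq> A. v A) =
        of_nat ((j - card C) choose (i - card C)) * v A"
      by auto
  qed
  also have "\<dots> = of_nat ((j - card C) choose (i - card C)) * upsum X v C"
    by (simp add: upsum_def sum_distrib_left)
  also have "\<dots> = 0" using v C by (simp add: kern_def)
  finally show "upsum X (level X i v) C = 0" .
qed

text \<open>Surjectivity comes from lifting polytabloids. With \<open>kern_Suc_iff\<close>, which
  computes the kernel of \<open>level\<close>, this identifies the factors of the kernel filtration
  with two-row Specht modules.\<close>

lemma level_image_kern:
  assumes "CHAR('a::field) = 2" "finite X" "i \<le> j" "i + j \<le> card X"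
  shows "level X i ` kern X j i = (kern X i i :: ('b set \<Rightarrow> 'a) set)"
proof
  show "level X i ` kern X j i \<subseteq> (kern X i i :: ('b set \<Rightarrow> 'a) set)"
    using level_in_kern[OF assms(2)] by blast
  show "(kern X i i :: ('b set \<Rightarrow> 'a) set) \<subseteq> level X i ` kern X j i"
  proof
    fix w :: "'b set \<Rightarrow> 'a" assume w: "w \<in> kern X i i"
    obtain v where v: "v \<in> kern X j i" "\<And>C. C \<subseteq> X \<Longrightarrow> card C = i \<Longrightarrow> upsum X v C = w C"
      using kern_lift[OF assms w] by blast
    have "w = level X i v"
    proof
      fix C show "w C = level X i v C"
        using w v(2)[of C] by (auto simp: level_def kern_def homog_def)
    qed
    then show "w \<in> level X i ` kern X j i" using v(1) by blast
  qed
qed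

lemma kern_Suc_iff:
  assumes v: "v \<in> kern X j i"
  shows "v \<in> kern X j (Suc i) \<longleftrightarrow> level X i v = 0"
proof
  assume "v \<in> kern X j (Suc i)"
  then show "level X i v = 0" by (auto simp: level_def kern_def)
next
  assume l: "level X i v = 0"
  have "upsum X v C = 0" if "C \<subseteq> X" "card C < Suc i" for C
  proof (cases "card C = i")
    case True
    then show ?thesis using fun_cong[OF l, of C] that by (simp add: level_def)
  next
    case False
    then show ?thesis using v that by (simp add: kern_def)
  qed
  then show "v \<in> kern X j (Suc i)" using v by (simp add: kern_def)
qed

lemma level_diff: "level X i (f - g) = level X i f - level X i g"
  by (auto simp: level_def upsum_diff)

text \<open>For odd \<open>j - i\<close>, writing \<open>v = raise X u\<close>, the vanishing of \<open>upsum X v\<close> one level further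
  down turns \<open>upsum X v\<close> into a double application of \<open>raise\<close>.\<close>

lemma level_eq_0_if_raise_eq_0:
  fixes v :: "'b set \<Rightarrow> 'a::field"
  assumes char: "CHAR('a) = 2" and X: "finite X" "even (card X)" "X \<noteq> {}"
    and odd: "odd (j - i)" and v: "v \<in> kern X j i" "raise X v = 0"
  shows "level X i v = 0"
proof
  fix C
  obtain u where u: "u \<in> homog X (j - 1)" "raise X u = v"
    using raise_exact[OF char X(1,3) _ v(2)] v(1) unfolding kern_def by blast
  have ij: "i < j" using odd by (cases "i < j") auto
  have "upsum X v C = 0" if C: "C \<subseteq> X" "card C = i"
  proof -
    \<comment> \<open>\<open>u\<close> has degree \<open>j - 1\<close>, so at level \<open>i\<close>
      the correction term of the commutation formula disappears.\<close>
    have "even (j - 1 + card C)" using odd ij C by presburger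
    then have "upsum X v C = raise X (upsum X u) C"
      using upsum_raise_CHAR_2[OF char X(1,2) C(1) u(1)] u(2) by simp
    \<comment> \<open>With one point less the parity is odd and the correction term is present. As
      \<open>upsum X v\<close> vanishes there, \<open>upsum X u\<close> agrees on these sets with
      its own image under \<open>raise\<close>.\<close>
    also have "\<dots> = raise X (raise X (upsum X u)) C"
    proof -
      have "upsum X u (C - {x}) = raise X (upsum X u) (C - {x})" if x: "x \<in> C" for x
      proof -
        have C': "C - {x} \<subseteq> X" "Suc (card (C - {x})) = i"
          using C x card_Suc_Diff1[OF finite_subset[OF C(1) X(1)] x] by auto
        then have "\<not> even (j - 1 + card (C - {x}))" using odd ij by presburger
        moreover have "upsum X v (C - {x}) = 0" using v(1) C' by (simp add: kern_def)
        ultimately have "raise X (upsum X u) (C - {x}) + upsum X u (C - {x}) = 0"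
          using upsum_raise_CHAR_2[OF char X(1,2) C'(1) u(1)] u(2) by simp
        then show ?thesis using uminus_CHAR_2[OF char] by (simp add: add_eq_0_iff)
      qed
      then show ?thesis using C(1) by (simp add: raise_def[of X _ C] cong: sum.cong)
    qed
    also have "\<dots> = 0" using raise_raise[OF char X(1)] by simp
    finally show ?thesis .
  qed
  then show "level X i v C = 0 C" by (simp add: level_def)
qed

text \<open>Subtracting \<open>raise X u\<close> from \<open>v\<close> does not change
  \<open>raise X v\<close>. Choosing \<open>u\<close> in degree \<open>j - 1\<close> with the same
  level as \<open>v\<close> works, since by parity \<open>raise X u\<close> has the level of
  \<open>u\<close>; the difference then lies one step deeper in the filtration.\<close>

lemma raise_kern_Suc:
  fixes X :: "'b set"
  assumes char: "CHAR('a::field) = 2" and X: "finite X" "even (card X)"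
    and ij: "even (j - i)" "i < j" "i + j \<le> card X"
  shows "raise X ` kern X j (Suc i) = raise X ` (kern X j i :: ('b set \<Rightarrow> 'a) set)"
proof
  show "raise X ` kern X j (Suc i) \<subseteq> raise X ` (kern X j i :: ('b set \<Rightarrow> 'a) set)"
    using kern_mono[of i "Suc i"] by (intro image_mono) auto
  show "raise X ` (kern X j i :: ('b set \<Rightarrow> 'a) set) \<subseteq> raise X ` kern X j (Suc i)"
  proof
    fix y :: "'b set \<Rightarrow> 'a" assume "y \<in> raise X ` kern X j i"
    then obtain v where v: "v \<in> kern X j i" "y = raise X v" by blast
    have "level X i v \<in> kern X i i" using level_in_kern[OF X(1) v(1)] .
    then obtain u where u: "u \<in> kern X (j - 1) i" "level X i v = level X i u"
      using level_image_kern[OF char X(1), of i "j - 1"] ij by force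
    have uh: "u \<in> homog X (j - 1)" using u by (simp add: kern_def)
    have up: "upsum X (raise X u) C = (if card C = i then upsum X u C else 0)"
      if C: "C \<subseteq> X" "card C \<le> i" for C
    proof -
      have "upsum X u (C - {x}) = 0" if "x \<in> C" for x
      proof -
        have "card (C - {x}) < i" "C - {x} \<subseteq> X"
          using that C finite_subset[OF C(1) X(1)] card_Diff1_less[of C x] by auto
        then show ?thesis using u(1) by (simp add: kern_def)
      qed
      then have "raise X (upsum X u) C = 0" by (simp add: raise_def)
      \<comment> \<open>At level \<open>i\<close> the correction term survives and reproduces
        \<open>upsum X u\<close>; at lower levels every term is zero because \<open>u\<close>
        satisfies the kernel conditions.\<close>
      moreover have "odd (j - 1 + i)" using ij by presburger
      moreover have "card C \<noteq> i \<Longrightarrow> upsum X u C = 0" using u(1) C by (simp add: kern_def)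
      ultimately show ?thesis using upsum_raise_CHAR_2[OF char X C(1) uh] by auto
    qed
    have "raise X u \<in> homog X j" using raise_homog[OF X(1) uh] ij by simp
    then have ru: "raise X u \<in> kern X j i" using up by (simp add: kern_def)
    have "level X i (raise X u) = level X i u"
      using up by (auto simp: level_def fun_eq_iff)
    then have "level X i (v - raise X u) = 0" using u(2) by (simp add: level_diff)
    moreover have "v - raise X u \<in> kern X j i"
      using fvec.subspace_diff[OF subspace_kern v(1) ru] .
    ultimately have "v - raise X u \<in> kern X j (Suc i)" using kern_Suc_iff by blast
    moreover have "raise X (v - raise X u) = y"
      using raise_raise[OF char X(1)] by (simp add: raise_diff v(2))
    ultimately show "y \<in> raise X ` kern X j (Suc i)" by blast
  qed
qed

text \<open>Two elements with the same image under \<open>raise\<close> differ by a closed element,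
  whose level vanishes by parity. Hence \<open>raise\<close> loses nothing in this factor of the
  filtration.\<close>

lemma raise_in_raise_kern_Suc_iff:
  fixes v :: "'b set \<Rightarrow> 'a::field"
  assumes char: "CHAR('a) = 2" and X: "finite X" "even (card X)" "X \<noteq> {}"
    and odd: "odd (j - i)" and v: "v \<in> kern X j i"
  shows "raise X v \<in> raise X ` kern X j (Suc i) \<longleftrightarrow> level X i v = 0"
proof
  assume "raise X v \<in> raise X ` kern X j (Suc i)"
  then obtain v' where v': "v' \<in> kern X j (Suc i)" "raise X v = raise X v'" by blast
  then have "v' \<in> kern X j i" using kern_mono[of i "Suc i"] by auto
  then have "v - v' \<in> kern X j i" using fvec.subspace_diff[OF subspace_kern v] by blast
  moreover have "raise X (v - v') = 0" using v'(2) by (simp add: raise_diff)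
  ultimately have "level X i (v - v') = 0"
    using level_eq_0_if_raise_eq_0[OF char X odd] by blast
  then show "level X i v = 0"
    using kern_Suc_iff[OF \<open>v' \<in> kern X j i\<close>] v'(1) by (simp add: level_diff)
next
  assume "level X i v = 0"
  then show "raise X v \<in> raise X ` kern X j (Suc i)" using kern_Suc_iff[OF v] by blast
qed

section \<open>Actions, embeddings and quotients\<close>

lemma permutes_image_subset_iff: "\<sigma> permutes X \<Longrightarrow> \<sigma> ` A \<subseteq> X \<longleftrightarrow> A \<subseteq> X"
  by (meson image_subset_iff permutes_in_image subset_iff)

lemma permutes_card_image: "\<sigma> permutes X \<Longrightarrow> card (\<sigma> ` A) = card A"
  by (meson card_image permutes_inj_on)

lemma permutes_image_inv:
  assumes "\<sigma> permutes X"
  shows "\<sigma> ` inv \<sigma> ` A = A" "inv \<sigma> ` \<sigma> ` A = A"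
  using permutes_inverses[OF assms] by (auto simp: image_image)

lemma upsum_act_set:
  assumes s: "\<sigma> permutes X"
  shows "upsum X (act_set \<sigma> f) C = upsum X f (inv \<sigma> ` C)"
proof -
  note s' = permutes_inv[OF s]
  have sub: "\<sigma> ` A \<subseteq> X \<longleftrightarrow> A \<subseteq> X" "inv \<sigma> ` A \<subseteq> X \<longleftrightarrow> A \<subseteq> X" for A
    using permutes_image_subset_iff s s' by blast+
  have flip: "inv \<sigma> ` C \<subseteq> A \<longleftrightarrow> C \<subseteq> \<sigma> ` A" for A
  proof
    assume "inv \<sigma> ` C \<subseteq> A"
    then have "\<sigma> ` inv \<sigma> ` C \<subseteq> \<sigma> ` A" by (rule image_mono)
    then show "C \<subseteq> \<sigma> ` A" by (simp only: permutes_image_inv[OF s])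
  next
    assume "C \<subseteq> \<sigma> ` A"
    then have "inv \<sigma> ` C \<subseteq> inv \<sigma> ` \<sigma> ` A" by (rule image_mono)
    then show "inv \<sigma> ` C \<subseteq> A" by (simp only: permutes_image_inv[OF s])
  qed
  show ?thesis
    unfolding upsum_def act_set_def
    by (rule sum.reindex_bij_witness[where i = "(`) \<sigma>" and j = "(`) (inv \<sigma>)"])
      (auto simp only: permutes_image_inv[OF s] sub flip mem_Collect_eq)
qed

lemma raise_act_set:
  assumes s: "\<sigma> permutes X"
  shows "raise X (act_set \<sigma> f) = act_set \<sigma> (raise X f)"
proof
  fix A
  note s' = permutes_inv[OF s]
  have inj: "inj_on (inv \<sigma>) B" for B using s' permutes_inj_on by blast
  have "(\<Sum>x\<in>A. f (inv \<sigma> ` (A - {x}))) = (\<Sum>y\<in>inv \<sigma> ` A. f (inv \<sigma> ` A - {y}))"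
    by (subst sum.reindex[OF inj])
      (auto simp: image_set_diff[OF permutes_inj[OF s']] intro!: sum.cong)
  then show "raise X (act_set \<sigma> f) A = act_set \<sigma> (raise X f) A"
    by (simp add: raise_def act_set_def permutes_image_subset_iff[OF s'])
qed

lemma act_set_homog:
  assumes s: "\<sigma> permutes X" and f: "f \<in> homog X j"
  shows "act_set \<sigma> f \<in> homog X j"
  unfolding homog_def
proof (intro CollectI allI impI)
  fix A assume "act_set \<sigma> f A \<noteq> 0"
  then have "inv \<sigma> ` A \<subseteq> X \<and> card (inv \<sigma> ` A) = j" using f by (auto simp: act_set_def homog_def)
  then show "A \<subseteq> X \<and> card A = j"
    by (simp add: permutes_image_subset_iff[OF permutes_inv[OF s]] permutes_card_image[OF permutes_inv[OF s]])
qed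

lemma act_set_kern:
  assumes s: "\<sigma> permutes X" and f: "f \<in> kern X j i"
  shows "act_set \<sigma> f \<in> kern X j i"
  using f act_set_homog[OF s, of f] permutes_image_subset_iff[OF permutes_inv[OF s]]
    permutes_card_image[OF permutes_inv[OF s]]
  by (simp add: kern_def upsum_act_set[OF s])

lemma level_act_set:
  assumes s: "\<sigma> permutes X"
  shows "level X i (act_set \<sigma> f) = act_set \<sigma> (level X i f)"
proof
  fix C
  show "level X i (act_set \<sigma> f) C = act_set \<sigma> (level X i f) C"
    unfolding level_def upsum_act_set[OF s]
    by (simp add: act_set_def permutes_image_subset_iff[OF permutes_inv[OF s]]
        permutes_card_image[OF permutes_inv[OF s]])
qed

lemma level_add: "level X i (f + g) = level X i f + level X i g"
  by (auto simp: level_def upsum_add)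

lemma level_scale: "level X i (fscale c f) = fscale c (level X i f)"
  unfolding level_def upsum_scale by (simp add: fscale_def fun_eq_iff)

text \<open>Pullback along \<open>key\<close>, which reads off one row of a tabloid: the second for
  two-row shapes, the first for hooks.\<close>

definition embed :: "tabloid set \<Rightarrow> (tabloid \<Rightarrow> 'b) \<Rightarrow> ('b \<Rightarrow> 'a::field) \<Rightarrow> tabloid \<Rightarrow> 'a" where
  "embed P key f T = (if T \<in> P then f (key T) else 0)"

lemma embed_add: "embed P key (f + g) = embed P key f + embed P key g"
  by (auto simp: embed_def)

lemma embed_scale: "embed P key (fscale c f) = scale c (embed P key f)"
  by (auto simp: embed_def fscale_def scale_def)

lemma module_hom_embed: "module_hom fscale scale (embed P key)"
  by (intro module_hom.intro module_hom_axioms.intro fvec.module_axioms tab.module_axioms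
      embed_add embed_scale)

lemma module_hom_raise: "module_hom fscale fscale (raise X)"
  by (intro module_hom.intro module_hom_axioms.intro fvec.module_axioms raise_add raise_scale)

text \<open>\<open>key\<close> need not be injective: hook tabloids with the same first row may
  differ in the order of the leg. Surjectivity onto the \<open>a\<close>-subsets is what makes
  \<open>embed\<close> injective on \<open>homog\<close>.\<close>

locale tabloid_key =
  fixes n a :: nat and P :: "tabloid set" and key :: "tabloid \<Rightarrow> nat set"
  assumes act_closed: "\<sigma> permutes {1..n} \<Longrightarrow> T \<in> P \<Longrightarrow> act_tabloid \<sigma> T \<in> P"
    and key_act: "T \<in> P \<Longrightarrow> key (act_tabloid \<sigma> T) = \<sigma> ` key T"
    and key_image: "key ` P = {A. A \<subseteq> {1..n} \<and> card A = a}"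
begin

lemma act_tabloid_inv:
  assumes "\<sigma> permutes {1..n}"
  shows "act_tabloid \<sigma> (act_tabloid (inv \<sigma>) T) = T" "act_tabloid (inv \<sigma>) (act_tabloid \<sigma> T) = T"
  using permutes_image_inv[OF assms] by (simp_all add: act_tabloid_def o_def map_idI)

lemma act_embed:
  assumes s: "\<sigma> permutes {1..n}"
  shows "act \<sigma> (embed P key f) = embed P key (act_set \<sigma> f)"
proof
  fix T
  have "act_tabloid (inv \<sigma>) T \<in> P \<longleftrightarrow> T \<in> P"
    using act_closed[OF s] act_closed[OF permutes_inv[OF s]] act_tabloid_inv[OF s] by metis
  then show "act \<sigma> (embed P key f) T = embed P key (act_set \<sigma> f) T"
    by (auto simp: act_def embed_def act_set_def key_act)
qed

lemma embed_eq_0_iff: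
  assumes "f \<in> homog {1..n} a"
  shows "embed P key f = 0 \<longleftrightarrow> f = 0"
proof
  assume *: "embed P key f = 0"
  have "f A = 0" for A
  proof (cases "A \<in> key ` P")
    case True
    then obtain T where "T \<in> P" "A = key T" by blast
    then show ?thesis using fun_cong[OF *, of T] by (simp add: embed_def)
  next
    case False
    then show ?thesis using assms by (auto simp: key_image homog_def)
  qed
  then show "f = 0" by auto
qed (auto simp: embed_def)

lemma inj_on_embed: "inj_on (embed P key) (homog {1..n} a :: (_ \<Rightarrow> 'a::field) set)"
proof (rule inj_onI)
  fix f g :: "nat set \<Rightarrow> 'a"
  assume *: "f \<in> homog {1..n} a" "g \<in> homog {1..n} a" "embed P key f = embed P key g"
  then have "f - g \<in> homog {1..n} a" using fvec.subspace_diff[OF subspace_homog] by blast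
  moreover have "embed P key (f - g) = 0"
    using *(3) by (simp add: module_hom.diff[OF module_hom_embed])
  ultimately have "f - g = 0" using embed_eq_0_iff by blast
  then show "f = g" by simp
qed

end

section \<open>Images and quotients as modules of the symmetric group\<close>

lemma subspace_image:
  assumes "\<And>f g. p (f + g) = p f + p g" "\<And>c f. p (fscale c f) = scale c (p f)"
    and "fvec.subspace K"
  shows "tab.subspace (p ` K)"
proof -
  have "module_hom fscale scale p"
    by (intro module_hom.intro module_hom_axioms.intro fvec.module_axioms tab.module_axioms assms)
  then show ?thesis using assms(3) module_hom.subspace_image by blast
qed

lemma act_add: "act \<sigma> (f + g) = act \<sigma> f + act \<sigma> g"
  by (simp add: act_def fun_eq_iff)

lemma act_act_inv:
  assumes "\<sigma> permutes X"
  shows "act \<sigma> (act (inv \<sigma>) f) = f"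
  using permutes_image_inv[OF assms] permutes_inv_inv[OF assms]
  by (simp add: act_def act_tabloid_def o_def map_idI)

text \<open>The first isomorphism theorem in a symmetric form: by \<open>ker\<close>, the preimage
  of \<open>N\<close> under \<open>p\<close> and the kernel of \<open>q\<close> are the same
  subspace of \<open>K\<close>, so both modules are the quotient of \<open>K\<close> by it. In the
  application \<open>p\<close> leads into the hook Specht module and \<open>q\<close> onto a two-row
  factor.\<close>

lemma sn_isomorphic_quotient:
  fixes p q :: "('b set \<Rightarrow> 'a::field) \<Rightarrow> tabloid \<Rightarrow> 'a"
  assumes p_add: "\<And>f g. p (f + g) = p f + p g" and p_scale: "\<And>c f. p (fscale c f) = scale c (p f)"
    and q_add: "\<And>f g. q (f + g) = q f + q g" and q_scale: "\<And>c f. q (fscale c f) = scale c (q f)"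
    and K: "fvec.subspace K" and N: "tab.subspace N"
    and actK: "\<And>\<sigma> f. \<sigma> permutes {1..n} \<Longrightarrow> f \<in> K \<Longrightarrow> A \<sigma> f \<in> K"
    and actp: "\<And>\<sigma> f. \<sigma> permutes {1..n} \<Longrightarrow> f \<in> K \<Longrightarrow> p (A \<sigma> f) = act \<sigma> (p f)"
    and actq: "\<And>\<sigma> f. \<sigma> permutes {1..n} \<Longrightarrow> f \<in> K \<Longrightarrow> q (A \<sigma> f) = act \<sigma> (q f)"
    and actN: "\<And>\<sigma> f. \<sigma> permutes {1..n} \<Longrightarrow> f \<in> N \<Longrightarrow> act \<sigma> f \<in> N"
    and ker: "\<And>f. f \<in> K \<Longrightarrow> p f \<in> N \<longleftrightarrow> q f = 0"
  shows "sn_isomorphic n (quotient_module (tab_module (p ` K)) N) (tab_module (q ` K))"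
proof -
  have hom: "module_hom fscale scale p" "module_hom fscale scale q"
    by (intro module_hom.intro module_hom_axioms.intro fvec.module_axioms tab.module_axioms
        p_add p_scale q_add q_scale)+
  define coset where "coset x = {x + y | y. y \<in> N}" for x
  have mem: "y \<in> coset x \<longleftrightarrow> y - x \<in> N" for x y
  proof
    assume "y - x \<in> N"
    then have "x + (y - x) \<in> coset x" unfolding coset_def by blast
    then show "y \<in> coset x" by simp
  qed (auto simp: coset_def)
  have self: "x \<in> coset x" for x using tab.subspace_0[OF N] by (simp add: mem)
  have coset_eq: "coset x = coset y" if "x - y \<in> N" for x y
  proof -
    have "z - x \<in> N \<longleftrightarrow> z - y \<in> N" for z
      using tab.subspace_add[OF N, of "z - x" "x - y"] tab.subspace_diff[OF N, of "z - y" "x - y"] that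
      by auto
    then show ?thesis by (auto simp: mem)
  qed
  \<comment> \<open>An element of the quotient is a coset, so \<open>h\<close> picks some preimage
    under \<open>p\<close>; by \<open>same\<close> below, \<open>q\<close> does not depend on the
    choice.\<close>
  define h where "h X = q (SOME v. v \<in> K \<and> p v \<in> X)" for X
  have same: "q v = q w \<longleftrightarrow> p v - p w \<in> N" if "v \<in> K" "w \<in> K" for v w
    using ker[OF fvec.subspace_diff[OF K that]] by (simp add: module_hom.diff[OF hom(1)] module_hom.diff[OF hom(2)])
  have h: "h (coset (p v)) = q v" if v: "v \<in> K" for v
  proof -
    let ?w = "SOME w. w \<in> K \<and> p w \<in> coset (p v)"
    have "?w \<in> K \<and> p ?w \<in> coset (p v)"
      by (rule someI[of _ v]) (simp add: v self)
    then have "q ?w = q v" using same[of ?w v] v by (simp add: mem)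
    then show ?thesis by (simp add: h_def)
  qed
  have carrier: "m_carrier (quotient_module (tab_module (p ` K)) N) = (\<lambda>v. coset (p v)) ` K"
    by (auto simp: quotient_module_def tab_module_def coset_def)
  have add: "m_add (quotient_module (tab_module (p ` K)) N) (coset x) (coset y) = coset (x + y)" for x y
  proof -
    have "{a + b | a b. a \<in> coset x \<and> b \<in> coset y} = coset (x + y)" (is "?L = _")
    proof
      show "?L \<subseteq> coset (x + y)"
      proof clarify
        fix a b assume "a \<in> coset x" "b \<in> coset y"
        then have "(a - x) + (b - y) \<in> N" unfolding mem by (rule tab.subspace_add[OF N])
        then show "a + b \<in> coset (x + y)" by (simp add: mem algebra_simps)
      qed
      show "coset (x + y) \<subseteq> ?L"
      proof
        fix z assume "z \<in> coset (x + y)"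
        then have "z - y \<in> coset x" by (simp add: mem algebra_simps)
        then have "(z - y) + y \<in> ?L" using self[of y] by blast
        then show "z \<in> ?L" by simp
      qed
    qed
    then show ?thesis by (simp add: quotient_module_def tab_module_def)
  qed
  have scale: "m_scale (quotient_module (tab_module (p ` K)) N) c (coset x) = coset (scale c x)" for c x
  proof -
    have "{scale c a + b | a b. a \<in> coset x \<and> b \<in> N} = coset (scale c x)" (is "?L = _")
    proof
      show "?L \<subseteq> coset (scale c x)"
      proof clarify
        fix a b assume "a \<in> coset x" "b \<in> N"
        then have "scale c (a - x) + b \<in> N"
          unfolding mem by (intro tab.subspace_add[OF N] tab.subspace_scale[OF N])
        then show "scale c a + b \<in> coset (scale c x)"
          by (simp add: mem tab.scale_right_diff_distrib algebra_simps)
      qed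
      show "coset (scale c x) \<subseteq> ?L"
        unfolding coset_def[of "scale c x"] using self[of x] by blast
    qed
    then show ?thesis by (simp add: quotient_module_def tab_module_def)
  qed
  have act: "m_act (quotient_module (tab_module (p ` K)) N) \<sigma> (coset x) = coset (act \<sigma> x)"
    if s: "\<sigma> permutes {1..n}" for \<sigma> x
  proof -
    have "act \<sigma> ` coset x = coset (act \<sigma> x)"
    proof
      show "act \<sigma> ` coset x \<subseteq> coset (act \<sigma> x)"
        using actN[OF s] by (auto simp: coset_def act_add)
      show "coset (act \<sigma> x) \<subseteq> act \<sigma> ` coset x"
      proof
        fix z assume "z \<in> coset (act \<sigma> x)"
        then obtain y where y: "y \<in> N" "z = act \<sigma> x + y" by (auto simp: coset_def)
        then have "z = act \<sigma> (x + act (inv \<sigma>) y)" by (simp add: act_add act_act_inv[OF s])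
        moreover have "x + act (inv \<sigma>) y \<in> coset x"
          using actN[OF permutes_inv[OF s] y(1)] by (auto simp: coset_def)
        ultimately show "z \<in> act \<sigma> ` coset x" by blast
      qed
    qed
    then show ?thesis by (simp add: quotient_module_def tab_module_def)
  qed
  show ?thesis
    unfolding sn_isomorphic_def carrier
  proof (intro exI[of _ h] conjI allI ballI impI)
    show "bij_betw h ((\<lambda>v. coset (p v)) ` K) (m_carrier (tab_module (q ` K)))"
      unfolding bij_betw_def
    proof
      show "inj_on h ((\<lambda>v. coset (p v)) ` K)"
        by (rule inj_onI) (auto simp: h same intro!: coset_eq)
      show "h ` (\<lambda>v. coset (p v)) ` K = m_carrier (tab_module (q ` K))"
        by (simp add: image_image h tab_module_def cong: image_cong)
    qed
  next
    fix X Y assume "X \<in> (\<lambda>v. coset (p v)) ` K" "Y \<in> (\<lambda>v. coset (p v)) ` K"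
    then obtain v w where vw: "v \<in> K" "w \<in> K" "X = coset (p v)" "Y = coset (p w)" by blast
    then show "h (m_add (quotient_module (tab_module (p ` K)) N) X Y) =
        m_add (tab_module (q ` K)) (h X) (h Y)"
      using h[OF fvec.subspace_add[OF K vw(1,2)]]
      by (simp add: add h p_add q_add) (simp add: tab_module_def)
  next
    fix c X assume "X \<in> (\<lambda>v. coset (p v)) ` K"
    then obtain v where v: "v \<in> K" "X = coset (p v)" by blast
    then show "h (m_scale (quotient_module (tab_module (p ` K)) N) c X) =
        m_scale (tab_module (q ` K)) c (h X)"
      using h[OF fvec.subspace_scale[OF K v(1)], of c]
      by (simp add: scale h p_scale q_scale) (simp add: tab_module_def)
  next
    fix \<sigma> :: "nat \<Rightarrow> nat" and X assume s: "\<sigma> permutes {1..n}" and "X \<in> (\<lambda>v. coset (p v)) ` K"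
    then obtain v where v: "v \<in> K" "X = coset (p v)" by blast
    then show "h (m_act (quotient_module (tab_module (p ` K)) N) \<sigma> X) =
        m_act (tab_module (q ` K)) \<sigma> (h X)"
      using h[OF actK[OF s v(1)]]
      by (simp add: act[OF s] h actp[OF s] actq[OF s]) (simp add: tab_module_def)
  qed
qed

section \<open>Tableaux and polytabloids in characteristic 2\<close>

lemma bij_betw_extend:
  assumes D: "finite D" "S \<subseteq> D" and X: "finite X" "card D = card X"
    and t: "inj_on t S" "t ` S \<subseteq> X"
  obtains t' where "bij_betw t' D X" "\<And>c. c \<in> S \<Longrightarrow> t' c = t c"
proof -
  have "card (D - S) = card (X - t ` S)"
    using D X t by (simp add: card_Diff_subset finite_subset card_image)
  then obtain g where g: "bij_betw g (D - S) (X - t ` S)"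
    using D X finite_same_card_bij by blast
  define t' where "t' c = (if c \<in> S then t c else g c)" for c
  have "bij_betw t' S (t ` S)"
    using t by (auto simp: bij_betw_def t'_def inj_on_def)
  moreover have "bij_betw t' (D - S) (X - t ` S)"
    using g by (rule bij_betw_cong[THEN iffD1, rotated]) (simp add: t'_def)
  ultimately have "bij_betw t' (S \<union> (D - S)) (t ` S \<union> (X - t ` S))"
    by (rule bij_betw_combine) auto
  then have "bij_betw t' D X" using D t by (simp add: Un_absorb1)
  then show ?thesis by (rule that) (simp add: t'_def)
qed

lemma diagram_eq_Sigma: "diagram l = (SIGMA i:{..<length l}. {..<l ! i})"
  by (auto simp: diagram_def)

lemma finite_diagram: "finite (diagram l)"
  by (simp add: diagram_eq_Sigma)

lemma card_diagram: "card (diagram l) = sum_list l"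
  by (simp add: diagram_eq_Sigma sum_list_sum_nth atLeast0LessThan)

lemma tableau_extend:
  assumes "S \<subseteq> diagram l" "inj_on t S" "t ` S \<subseteq> {1..sum_list l}"
  obtains t' where "t' \<in> tableaux l" "\<And>c. c \<in> S \<Longrightarrow> t' c = t c"
  using bij_betw_extend[OF finite_diagram assms(1) _ _ assms(2,3)]
  by (auto simp: tableaux_def card_diagram)

lemma perm_of_tableaux:
  assumes "s \<in> tableaux l" "t \<in> tableaux l"
  obtains \<sigma> where "\<sigma> permutes {1..sum_list l}" "\<And>c. c \<in> diagram l \<Longrightarrow> \<sigma> (t c) = s c"
proof -
  let ?D = "diagram l" and ?n = "sum_list l"
  have s: "bij_betw s ?D {1..?n}" and t: "bij_betw t ?D {1..?n}"
    using assms by (auto simp: tableaux_def)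
  define \<sigma> where "\<sigma> = (\<lambda>x. if x \<in> {1..?n} then s (inv_into ?D t x) else x)"
  have val: "\<sigma> (t c) = s c" if "c \<in> ?D" for c
    using that t bij_betwE[OF t] by (auto simp: \<sigma>_def bij_betw_def inv_into_f_f)
  have "bij_betw (s \<circ> inv_into ?D t) {1..?n} {1..?n}"
    using bij_betw_trans[OF bij_betw_inv_into[OF t] s] .
  then have "bij_betw \<sigma> {1..?n} {1..?n}"
    by (rule bij_betw_cong[THEN iffD1, rotated]) (simp add: \<sigma>_def)
  then have "\<sigma> permutes {1..?n}"
    by (rule bij_imp_permutes) (simp only: \<sigma>_def if_False)
  then show ?thesis using that val by blast
qed

lemma row_image_eq:
  assumes "\<And>c. c \<in> diagram l \<Longrightarrow> \<sigma> (t c) = s c"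
  shows "\<sigma> ` row l t i = row l s i" "\<sigma> ` column l t i = column l s i"
  using assms by (force simp: row_def column_def image_image intro!: image_cong)+

lemma act_tabloid_of:
  assumes "\<And>c. c \<in> diagram l \<Longrightarrow> \<sigma> (t c) = s c"
  shows "act_tabloid \<sigma> (tabloid_of l t) = tabloid_of l s"
  using row_image_eq(1)[of l \<sigma> t s, OF assms] by (simp add: act_tabloid_def tabloid_of_def)

lemma tableau_comp:
  assumes "\<sigma> permutes {1..sum_list l}" "t \<in> tableaux l"
  shows "\<sigma> \<circ> t \<in> tableaux l"
  using assms bij_betw_trans permutes_imp_bij by (fastforce simp: tableaux_def)

text \<open>In characteristic 2 the signs disappear; if column-equivalent tableaux are separated by their
  tabloids, no tabloid is hit twice.\<close>

lemma polytabloid_CHAR_2: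
  assumes char: "CHAR('a::field) = 2" and t: "t \<in> tableaux l"
    and uniq: "\<And>s s' c. s \<in> tableaux l \<Longrightarrow> s' \<in> tableaux l \<Longrightarrow>
      (\<And>j. column l s j = column l t j) \<Longrightarrow> (\<And>j. column l s' j = column l t j) \<Longrightarrow>
      tabloid_of l s = tabloid_of l s' \<Longrightarrow> c \<in> diagram l \<Longrightarrow> s c = s' c"
  shows "(polytabloid l t :: tabloid \<Rightarrow> 'a) T =
    of_bool (\<exists>s \<in> tableaux l. (\<forall>j. column l s j = column l t j) \<and> tabloid_of l s = T)"
proof -
  let ?C = "column_stabilizer l t" and ?f = "\<lambda>\<sigma>. act_tabloid \<sigma> (tabloid_of l t)"
  have fin: "finite ?C"
    by (rule finite_subset[OF _ finite_permutations[of "{1..sum_list l}"]])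
      (auto simp: column_stabilizer_def)
  have stab: "\<sigma> \<circ> t \<in> tableaux l" "column l (\<sigma> \<circ> t) j = column l t j" "?f \<sigma> = tabloid_of l (\<sigma> \<circ> t)"
    if \<sigma>: "\<sigma> \<in> ?C" for \<sigma> j
  proof -
    have perm: "\<sigma> permutes {1..sum_list l}" and col: "\<sigma> ` column l t j = column l t j"
      using \<sigma> by (simp_all add: column_stabilizer_def)
    show "\<sigma> \<circ> t \<in> tableaux l" by (rule tableau_comp[OF perm t])
    show "column l (\<sigma> \<circ> t) j = column l t j"
      using row_image_eq(2)[of l \<sigma> t "\<sigma> \<circ> t" j] col by simp
    show "?f \<sigma> = tabloid_of l (\<sigma> \<circ> t)" by (rule act_tabloid_of) simp
  qed
  have inj: "inj_on ?f ?C"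
  proof (rule inj_onI)
    fix \<sigma> \<tau> assume st: "\<sigma> \<in> ?C" "\<tau> \<in> ?C" "?f \<sigma> = ?f \<tau>"
    have eq: "(\<sigma> \<circ> t) c = (\<tau> \<circ> t) c" if "c \<in> diagram l" for c
    proof (rule uniq)
      show "tabloid_of l (\<sigma> \<circ> t) = tabloid_of l (\<tau> \<circ> t)"
        using st(3) by (simp only: stab(3)[OF st(1)] stab(3)[OF st(2)])
    qed (simp_all only: stab(1,2)[OF st(1)] stab(1,2)[OF st(2)] that)
    have "\<sigma> x = \<tau> x" for x
    proof (cases "x \<in> {1..sum_list l}")
      case True
      moreover have "t ` diagram l = {1..sum_list l}"
        using t by (simp add: tableaux_def bij_betw_def)
      ultimately obtain c where "c \<in> diagram l" "x = t c" by blast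
      then show ?thesis using eq by simp
    next
      case False
      then show ?thesis using st(1,2) by (auto simp: column_stabilizer_def permutes_def)
    qed
    then show "\<sigma> = \<tau>" by auto
  qed
  have sign: "(of_int (sign \<sigma>) :: 'a) = 1" for \<sigma> :: "nat \<Rightarrow> nat"
    using uminus_CHAR_2[OF char, of 1] by (auto simp: sign_def)
  have eval: "(\<Sum>\<sigma>\<in>S. scale (of_int (sign \<sigma>)) (single (?f \<sigma>) :: tabloid \<Rightarrow> 'a)) T =
      (\<Sum>\<sigma>\<in>S. if ?f \<sigma> = T then 1 else 0)" for S
    by (induction S rule: infinite_finite_induct) (auto simp: sign scale_def single_def)
  have "(polytabloid l t :: tabloid \<Rightarrow> 'a) T = (\<Sum>\<sigma>\<in>?C. if ?f \<sigma> = T then 1 else 0)"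
    unfolding polytabloid_def eval ..
  \<comment> \<open>Injectivity rules out repeated tabloids, whose coefficients could otherwise
    cancel in characteristic 2.\<close>
  also have "\<dots> = (\<Sum>S\<in>?f ` ?C. if S = T then 1 else 0)"
    by (simp add: sum.reindex[OF inj])
  also have "\<dots> = of_bool (T \<in> ?f ` ?C)" using fin by simp
  also have "T \<in> ?f ` ?C \<longleftrightarrow>
      (\<exists>s \<in> tableaux l. (\<forall>j. column l s j = column l t j) \<and> tabloid_of l s = T)"
  proof
    assume "T \<in> ?f ` ?C"
    then obtain \<sigma> where "\<sigma> \<in> ?C" "T = ?f \<sigma>" by blast
    then show "\<exists>s \<in> tableaux l. (\<forall>j. column l s j = column l t j) \<and> tabloid_of l s = T"
      using stab by (intro bexI[of _ "\<sigma> \<circ> t"] conjI allI) simp_all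
  next
    assume "\<exists>s \<in> tableaux l. (\<forall>j. column l s j = column l t j) \<and> tabloid_of l s = T"
    then obtain s where s: "s \<in> tableaux l" "\<forall>j. column l s j = column l t j" "tabloid_of l s = T"
      by blast
    obtain \<sigma> where \<sigma>: "\<sigma> permutes {1..sum_list l}" "\<And>c. c \<in> diagram l \<Longrightarrow> \<sigma> (t c) = s c"
      using perm_of_tableaux[OF s(1) t] by blast
    have "\<sigma> \<in> ?C" using \<sigma>(1) row_image_eq(2)[of l \<sigma> t s, OF \<sigma>(2)] s(2) by (simp add: column_stabilizer_def)
    moreover have "?f \<sigma> = T" using act_tabloid_of[of l \<sigma> t s, OF \<sigma>(2)] s(3) by simp
    ultimately show "T \<in> ?f ` ?C" by blast
  qed
  finally show ?thesis .
qed

lemma tableau_with_row: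
  assumes "i < length l" "A \<subseteq> {1..sum_list l}" "card A = l ! i"
  shows "\<exists>t \<in> tableaux l. row l t i = A"
proof -
  define S where "S = {c \<in> diagram l. fst c = i}"
  have S: "S \<subseteq> diagram l" "S = Pair i ` {..<l ! i}"
    using assms(1) by (auto simp: S_def diagram_def)
  have "card S = card A" "finite S"
    unfolding S(2) by (simp_all add: card_image inj_on_def assms(3))
  then obtain g where g: "bij_betw g S A"
    using finite_same_card_bij[of S A] finite_subset[OF assms(2)] by auto
  have "inj_on g S" "g ` S \<subseteq> {1..sum_list l}"
    using g assms(2) by (simp_all add: bij_betw_def)
  from tableau_extend[OF S(1) this]
  obtain t where t: "t \<in> tableaux l" "\<And>c. c \<in> S \<Longrightarrow> t c = g c" by blast
  have "row l t i = g ` S" unfolding row_def S_def[symmetric] using t(2) by (rule image_cong[OF refl])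
  then show ?thesis using t(1) g by (auto simp: bij_betw_def)
qed

text \<open>Any row can serve as the key: a filling of that row by a set of the right size extends
  to a tableau.\<close>

lemma tabloid_key_tabloids:
  assumes "sum_list l = n" "i < length l"
  shows "tabloid_key n (l ! i) (tabloids l) (\<lambda>T. T ! i)"
proof
  show "act_tabloid \<sigma> T \<in> tabloids l" if "\<sigma> permutes {1..n}" "T \<in> tabloids l" for \<sigma> T
    using that act_tabloid_in_tabloids assms(1) by (auto simp: tabloids_def)
  show "act_tabloid \<sigma> T ! i = \<sigma> ` (T ! i)" if "T \<in> tabloids l" for \<sigma> T
    using that assms(2) by (auto simp: tabloids_def tabloid_of_def act_tabloid_def)
  show "(\<lambda>T. T ! i) ` tabloids l = {A. A \<subseteq> {1..n} \<and> card A = l ! i}"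
  proof
    show "(\<lambda>T. T ! i) ` tabloids l \<subseteq> {A. A \<subseteq> {1..n} \<and> card A = l ! i}"
    proof clarify
      fix T assume "T \<in> tabloids l"
      then obtain t where t: "t \<in> tableaux l" "T = tabloid_of l t" by (auto simp: tabloids_def)
      have bij: "bij_betw t (diagram l) {1..n}" using t assms(1) by (simp add: tableaux_def)
      have cells: "{c \<in> diagram l. fst c = i} = Pair i ` {..<l ! i}"
        using assms(2) by (auto simp: diagram_def)
      have "inj_on t {c \<in> diagram l. fst c = i}"
        by (rule inj_on_subset[OF bij_betw_imp_inj_on[OF bij]]) auto
      then have "card (row l t i) = card {c \<in> diagram l. fst c = i}"
        unfolding row_def by (rule card_image)
      then have "card (row l t i) = l ! i"
        unfolding cells by (simp add: card_image inj_on_def)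
      moreover have "row l t i \<subseteq> {1..n}"
        unfolding row_def bij_betw_imp_surj_on[OF bij, symmetric] by (rule image_mono) auto
      ultimately show "T ! i \<subseteq> {1..n} \<and> card (T ! i) = l ! i"
        using t assms(2) by (simp add: tabloid_of_def)
    qed
    show "{A. A \<subseteq> {1..n} \<and> card A = l ! i} \<subseteq> (\<lambda>T. T ! i) ` tabloids l"
    proof clarify
      fix A assume "A \<subseteq> {1..n}" "card A = l ! i"
      then obtain t where t: "t \<in> tableaux l" "row l t i = A"
        using tableau_with_row[OF assms(2), of A] assms(1) by auto
      then have "A = tabloid_of l t ! i" using assms(2) by (simp add: tabloid_of_def)
      then show "A \<in> (\<lambda>T. T ! i) ` tabloids l"
        by (rule image_eqI) (simp add: tabloids_def t(1))
    qed
  qed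
qed

section \<open>Two-row partitions\<close>

lemma diagram_two_row: "diagram [p, q] = {0} \<times> {..<p} \<union> {1} \<times> {..<q}"
  by (auto simp: diagram_def less_Suc_eq nth_Cons')

lemma column_two_row:
  assumes "q \<le> p"
  shows "j < q \<Longrightarrow> column [p, q] t j = {t (0, j), t (1, j)}"
    "q \<le> j \<Longrightarrow> j < p \<Longrightarrow> column [p, q] t j = {t (0, j)}"
proof -
  show "column [p, q] t j = {t (0, j), t (1, j)}" if "j < q"
  proof -
    have "{c \<in> diagram [p, q]. snd c = j} = {(0, j), (1, j)}"
      using that assms by (auto simp: diagram_two_row)
    then show ?thesis by (simp add: column_def)
  qed
  show "column [p, q] t j = {t (0, j)}" if "q \<le> j" "j < p"
  proof -
    have "{c \<in> diagram [p, q]. snd c = j} = {(0, j)}"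
      using that by (auto simp: diagram_two_row)
    then show ?thesis by (simp add: column_def)
  qed
qed

lemma row_two_row: "row [p, q] t 0 = t ` ({0} \<times> {..<p})" "row [p, q] t 1 = t ` ({1} \<times> {..<q})"
proof -
  have "{c \<in> diagram [p, q]. fst c = 0} = {0} \<times> {..<p}" "{c \<in> diagram [p, q]. fst c = 1} = {1} \<times> {..<q}"
    by (auto simp: diagram_two_row)
  then show "row [p, q] t 0 = t ` ({0} \<times> {..<p})" "row [p, q] t 1 = t ` ({1} \<times> {..<q})"
    by (simp_all only: row_def)
qed

lemma tabloid_of_two_row:
  assumes t: "t \<in> tableaux [p, q]"
  shows "tabloid_of [p, q] t = [{1..p + q} - row [p, q] t 1, row [p, q] t 1]"
proof -
  have bij: "bij_betw t (diagram [p, q]) {1..p + q}" using t by (simp add: tableaux_def)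
  have "{1..p + q} - row [p, q] t 1 = t ` (diagram [p, q] - {1} \<times> {..<q})"
    unfolding row_two_row(2) bij_betw_imp_surj_on[OF bij, symmetric]
    by (rule inj_on_image_set_diff[OF bij_betw_imp_inj_on[OF bij], symmetric])
      (auto simp: diagram_two_row)
  also have "diagram [p, q] - {1} \<times> {..<q} = {0} \<times> {..<p}"
    by (auto simp: diagram_two_row)
  finally show ?thesis by (simp add: tabloid_of_def row_two_row)
qed

lemma tabloids_two_row:
  "tabloids [p, q] = (\<lambda>A. [{1..p + q} - A, A]) ` {A. A \<subseteq> {1..p + q} \<and> card A = q}"
proof -
  interpret tabloid_key "p + q" q "tabloids [p, q]" "\<lambda>T. T ! 1"
    using tabloid_key_tabloids[of "[p, q]" "p + q" 1] by simp
  have T: "T = [{1..p + q} - T ! 1, T ! 1]" if "T \<in> tabloids [p, q]" for T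
    using that by (auto simp: tabloids_def tabloid_of_two_row)
  show ?thesis
    unfolding key_image[symmetric] image_image using T by (auto intro: image_eqI)
qed

lemma mem_column_two_row:
  assumes q: "q \<le> p" and s: "\<And>j. column [p, q] s j = column [p, q] t j"
  shows "j < q \<Longrightarrow> {s (0, j), s (1, j)} = {t (0, j), t (1, j)}"
    "q \<le> j \<Longrightarrow> j < p \<Longrightarrow> s (0, j) = t (0, j)"
  using s[of j] by (simp_all only: column_two_row[OF q]) simp

lemma pairs_subset_diagram: "q \<le> p \<Longrightarrow> pairs q \<subseteq> diagram [p, q]"
  by (auto simp: pairs_def diagram_two_row)

text \<open>Two column-equivalent tableaux with the same second row agree: \<open>s (1, j)\<close> is the only entry of
  the second row that lies in column \<open>j\<close>.\<close>

lemma two_row_tableau_unique: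
  assumes q: "q \<le> p" and t: "t \<in> tableaux [p, q]"
    and s: "s \<in> tableaux [p, q]" "\<And>j. column [p, q] s j = column [p, q] t j"
    and s': "s' \<in> tableaux [p, q]" "\<And>j. column [p, q] s' j = column [p, q] t j"
    and eq: "tabloid_of [p, q] s = tabloid_of [p, q] s'" and c: "c \<in> diagram [p, q]"
  shows "s c = s' c"
proof -
  have bij: "bij_betw t (diagram [p, q]) {1..p + q}" using t by (simp add: tableaux_def)
  have rows: "s ` ({1} \<times> {..<q}) = s' ` ({1} \<times> {..<q})"
  proof -
    have "row [p, q] s 1 = row [p, q] s' 1"
      using eq unfolding tabloid_of_two_row[OF s(1)] tabloid_of_two_row[OF s'(1)] by simp
    then show ?thesis by (simp only: row_two_row)
  qed
  have one: "s (1, j) = s' (1, j)" if j: "j < q" for j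
  proof -
    have "s (1, j) \<in> s' ` ({1} \<times> {..<q})" using j unfolding rows[symmetric] by auto
    then obtain k where k: "k < q" "s (1, j) = s' (1, k)" by auto
    have "s (1, j) \<in> {t (0, j), t (1, j)}" "s' (1, k) \<in> {t (0, k), t (1, k)}"
      using mem_column_two_row(1)[OF q s(2) j] mem_column_two_row(1)[OF q s'(2) k(1)] by auto
    then have "\<exists>u\<in>{0, 1}. s (1, j) = t (u, j)" "\<exists>v\<in>{0, 1}. s' (1, k) = t (v, k)" by auto
    then obtain u v where uv: "u \<in> {0, 1}" "v \<in> {0, 1}" "t (u, j) = t (v, k)"
      using k(2) by (elim bexE) simp
    have "(u, j) \<in> diagram [p, q]" "(v, k) \<in> diagram [p, q]"
      using uv(1,2) j k(1) q by (auto simp: diagram_two_row)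
    then have "(u, j) = (v, k)"
      using inj_onD[OF bij_betw_imp_inj_on[OF bij] uv(3)] by blast
    then show ?thesis using k(2) by simp
  qed
  have zero: "s (0, j) = s' (0, j)" if "j < p" for j
  proof (cases "j < q")
    case True
    have "(0, j) \<in> diagram [p, q]" "(1, j) \<in> diagram [p, q]"
      using that True by (auto simp: diagram_two_row)
    then have "s (0, j) \<noteq> s (1, j)" "s' (0, j) \<noteq> s' (1, j)"
      using s(1) s'(1) by (auto simp: tableaux_def bij_betw_def dest: inj_onD)
    then show ?thesis
      using mem_column_two_row(1)[OF q s(2) True] mem_column_two_row(1)[OF q s'(2) True] one[OF True]
      by (metis doubleton_eq_iff)
  next
    case False
    then show ?thesis using mem_column_two_row(2)[OF q s(2), of j] mem_column_two_row(2)[OF q s'(2), of j] that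
      by simp
  qed
  from c show ?thesis unfolding diagram_two_row using one zero by auto
qed

text \<open>Column-equivalent tableaux arise by flipping two-entry columns, so each such column has
  exactly one entry in the second row. Conversely, every transversal is reached by flipping the
  columns whose upper entry it contains.\<close>

lemma two_row_orbit:
  assumes q: "q \<le> p" and t: "t \<in> tableaux [p, q]"
  shows "(\<exists>s \<in> tableaux [p, q]. (\<forall>j. column [p, q] s j = column [p, q] t j) \<and> tabloid_of [p, q] s = T)
    \<longleftrightarrow> T \<in> tabloids [p, q] \<and> transversal q t (T ! 1)" (is "?L \<longleftrightarrow> ?R")
proof
  assume ?L
  then obtain s where s: "s \<in> tableaux [p, q]" "\<And>j. column [p, q] s j = column [p, q] t j"
    "tabloid_of [p, q] s = T" by blast
  have inj: "inj_on s (diagram [p, q])" using s(1) by (simp add: tableaux_def bij_betw_def)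
  have T1: "T ! 1 = s ` ({1} \<times> {..<q})"
    unfolding s(3)[symmetric] tabloid_of_two_row[OF s(1)] row_two_row by simp
  have col: "{s (0, j), s (1, j)} = {t (0, j), t (1, j)}" if "j < q" for j
    using mem_column_two_row(1)[OF q s(2) that] .
  have "T ! 1 \<subseteq> t ` pairs q"
  proof
    fix x assume "x \<in> T ! 1"
    then obtain j where j: "j < q" "x = s (1, j)" unfolding T1 by auto
    then have "x \<in> {t (0, j), t (1, j)}" using col[OF j(1)] by blast
    then show "x \<in> t ` pairs q" using j(1) by (auto simp: pairs_def)
  qed
  moreover have "(t (0, j) \<in> T ! 1) \<noteq> (t (1, j) \<in> T ! 1)" if j: "j < q" for j
  proof -
    have "s (1, j) \<in> T ! 1" unfolding T1 using j by auto
    moreover have "s (0, j) \<notin> T ! 1"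
    proof
      assume "s (0, j) \<in> T ! 1"
      then obtain k where "k < q" "s (0, j) = s (1, k)" unfolding T1 by auto
      then show False using inj_onD[OF inj, of "(0, j)" "(1, k)"] j q by (auto simp: diagram_two_row)
    qed
    ultimately show ?thesis using col[OF j] by (metis doubleton_eq_iff)
  qed
  moreover have "T \<in> tabloids [p, q]" using s by (auto simp: tabloids_def)
  ultimately show ?R by (auto simp: transversal_def)
next
  assume R: ?R
  then obtain A where A: "A \<subseteq> {1..p + q}" "card A = q" "T = [{1..p + q} - A, A]"
    by (auto simp: tabloids_two_row)
  then have trans: "transversal q t A" using R by simp
  have bij: "bij_betw t (diagram [p, q]) {1..p + q}" using t by (simp add: tableaux_def)
  \<comment> \<open>This involution on cells flips exactly the columns whose upper entry must move
    to the second row; \<open>1 - fst c\<close> exchanges rows 0 and 1.\<close>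
  define w where "w c = (if snd c < q \<and> t (0, snd c) \<in> A then (1 - fst c, snd c) else c)"
    for c :: "nat \<times> nat"
  have w: "w c \<in> diagram [p, q]" "w (w c) = c" if "c \<in> diagram [p, q]" for c
    using that q by (auto simp: w_def diagram_two_row)
  have "bij_betw w (diagram [p, q]) (diagram [p, q])"
    by (rule bij_betw_byWitness[where f' = w]) (use w in auto)
  then have s: "t \<circ> w \<in> tableaux [p, q]"
    using bij_betw_trans bij by (auto simp: tableaux_def)
  have "column [p, q] (t \<circ> w) j = column [p, q] t j" for j
  proof -
    have "w ` {c \<in> diagram [p, q]. snd c = j} = {c \<in> diagram [p, q]. snd c = j}"
    proof -
      have "w c \<in> {c \<in> diagram [p, q]. snd c = j}" if "c \<in> {c \<in> diagram [p, q]. snd c = j}" for c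
        using that w(1)[of c] by (auto simp: w_def)
      then show ?thesis using w(2) by (force intro: image_eqI[of _ w "w _"])
    qed
    then show ?thesis unfolding column_def image_comp[symmetric] by simp
  qed
  moreover have "tabloid_of [p, q] (t \<circ> w) = T"
  proof -
    have "row [p, q] (t \<circ> w) 1 = A"
    proof
      show "row [p, q] (t \<circ> w) 1 \<subseteq> A"
        unfolding row_two_row using trans by (auto simp: w_def transversal_def)
      show "A \<subseteq> row [p, q] (t \<circ> w) 1"
      proof
        fix x assume x: "x \<in> A"
        then obtain c where c: "c \<in> pairs q" "x = t c"
          using trans unfolding transversal_def by blast
        obtain u j where "c = (u, j)" by (cases c)
        with c have uj: "u \<in> {0, 1}" "j < q" "x = t (u, j)" by (simp_all add: pairs_def)
        have "x = (t \<circ> w) (1, j)"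
          using uj x trans by (auto simp: w_def transversal_def)
        then show "x \<in> row [p, q] (t \<circ> w) 1" unfolding row_two_row using uj(2) by auto
      qed
    qed
    then show ?thesis using tabloid_of_two_row[OF s] A(3) by simp
  qed
  ultimately show ?L using s by blast
qed

lemma polytabloid_two_row:
  assumes char: "CHAR('a::field) = 2" and q: "q \<le> p" and t: "t \<in> tableaux [p, q]"
  shows "(polytabloid [p, q] t :: tabloid \<Rightarrow> 'a) =
    embed (tabloids [p, q]) (\<lambda>T. T ! 1) (transversals q t {})"
proof
  fix T
  have "(polytabloid [p, q] t :: tabloid \<Rightarrow> 'a) T =
      of_bool (\<exists>s \<in> tableaux [p, q]. (\<forall>j. column [p, q] s j = column [p, q] t j) \<and> tabloid_of [p, q] s = T)"
    by (rule polytabloid_CHAR_2[OF char t]) (rule two_row_tableau_unique[OF q t])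
  then show "(polytabloid [p, q] t :: tabloid \<Rightarrow> 'a) T =
      embed (tabloids [p, q]) (\<lambda>T. T ! 1) (transversals q t {}) T"
    unfolding two_row_orbit[OF q t] by (simp add: embed_def transversals_def)
qed

text \<open>Transversals depend only on the entries in \<open>pairs q\<close>, and an injective
  filling of these cells extends to a tableau.\<close>

lemma polys_eq_tableaux:
  assumes q: "q \<le> p"
  shows "polys {1..p + q} q = (\<lambda>t. transversals q t {}) ` tableaux [p, q]"
proof
  show "polys {1..p + q} q \<subseteq> (\<lambda>t. transversals q t {} :: _ \<Rightarrow> 'a) ` tableaux [p, q]"
  proof
    fix f :: "nat set \<Rightarrow> 'a" assume "f \<in> polys {1..p + q} q"
    then obtain t where t: "f = transversals q t {}" "inj_on t (pairs q)" "t ` pairs q \<subseteq> {1..sum_list [p, q]}"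
      by (auto simp: polys_def)
    from tableau_extend[OF pairs_subset_diagram[OF q] t(2,3)]
    obtain t' where t': "t' \<in> tableaux [p, q]" "\<And>c. c \<in> pairs q \<Longrightarrow> t' c = t c" by blast
    have "t' ` pairs q = t ` pairs q" using t'(2) by (rule image_cong[OF refl])
    moreover have "t' (0, j) = t (0, j)" "t' (1, j) = t (1, j)" if "j < q" for j
      using t'(2) that by (auto simp: pairs_def)
    ultimately have "transversal q t' A = transversal q t A" for A
      by (auto simp: transversal_def)
    then have "f = transversals q t' {}" by (simp add: t(1) transversals_def fun_eq_iff)
    then show "f \<in> (\<lambda>t. transversals q t {}) ` tableaux [p, q]" using t'(1) by (rule image_eqI)
  qed
  show "(\<lambda>t. transversals q t {} :: _ \<Rightarrow> 'a) ` tableaux [p, q] \<subseteq> polys {1..p + q} q"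
  proof
    fix f :: "nat set \<Rightarrow> 'a" assume "f \<in> (\<lambda>t. transversals q t {}) ` tableaux [p, q]"
    then obtain t where t: "f = transversals q t {}" "t \<in> tableaux [p, q]" by blast
    then have bij: "bij_betw t (diagram [p, q]) {1..p + q}" by (simp add: tableaux_def)
    have "inj_on t (pairs q)" "t ` pairs q \<subseteq> {1..p + q}"
      using inj_on_subset[OF bij_betw_imp_inj_on[OF bij] pairs_subset_diagram[OF q]]
        image_mono[OF pairs_subset_diagram[OF q], of t] bij_betw_imp_surj_on[OF bij] by simp_all
    then show "f \<in> polys {1..p + q} q" using t(1) by (auto simp: polys_def)
  qed
qed

text \<open>The kernel intersection theorem carried over to tabloids: polytabloids are the embedded
  members of \<open>polys\<close>, and \<open>embed\<close> commutes with spans.\<close>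

lemma specht_two_row:
  assumes char: "CHAR('a::field) = 2" and q: "q \<le> p"
  shows "(specht [p, q] :: (tabloid \<Rightarrow> 'a) set) =
    embed (tabloids [p, q]) (\<lambda>T. T ! 1) ` kern {1..p + q} q q"
proof -
  have "polytabloid [p, q] ` tableaux [p, q] =
      embed (tabloids [p, q]) (\<lambda>T. T ! 1) ` (polys {1..p + q} q :: (nat set \<Rightarrow> 'a) set)"
    unfolding polys_eq_tableaux[OF q] image_image
    by (rule image_cong[OF refl]) (rule polytabloid_two_row[OF char q])
  then show ?thesis
    unfolding specht_def using kern_eq_span_polys[OF char, of "{1..p + q}" q]
    by (simp add: module_hom.span_image[OF module_hom_embed])
qed

text \<open>The \<open>b\<close>-subsets of a set of size \<open>b + 1\<close> are obtained by
  deleting one point, which is how \<open>raise\<close> is defined. The condition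
  \<open>0 < a\<close> ensures that \<open>a - 1\<close> and \<open>b + 1\<close> again add up to
  \<open>a + b\<close>.\<close>

lemma theta_embed:
  assumes a: "0 < a" and f: "f \<in> homog {1..a + b} b"
  shows "theta a b (embed (tabloids [a, b]) (\<lambda>T. T ! 1) f) =
    (embed (tabloids [a - 1, b + 1]) (\<lambda>T. T ! 1) (raise {1..a + b} f) :: tabloid \<Rightarrow> 'a::field)"
proof
  fix T
  let ?X = "{1..a + b}" and ?P = "tabloids [a - 1, b + 1]"
  let ?S = "{A. A \<subseteq> ?X \<and> card A = b}"
  have finP: "finite ?P" unfolding tabloids_two_row by simp
  have single: "(\<Sum>U\<in>Q. single U :: tabloid \<Rightarrow> 'a) T = of_bool (T \<in> Q)" if "finite Q" for Q
    using that by (induction Q) (auto simp: single_def)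
  have ev: "(\<Sum>S\<in>Q. scale (g S) (h S)) T = (\<Sum>S\<in>Q. g S * h S T)" for Q and g :: "tabloid \<Rightarrow> 'a" and h
    by (induction Q rule: infinite_finite_induct) (auto simp: scale_def)
  have "theta a b (embed (tabloids [a, b]) (\<lambda>T. T ! 1) f) T =
      (\<Sum>S\<in>tabloids [a, b]. f (S ! 1) * of_bool (T \<in> ?P \<and> S ! 1 \<subseteq> T ! 1))"
    unfolding theta_def ev using finP by (simp add: single embed_def)
  also have "\<dots> = (\<Sum>A\<in>?S. f A * of_bool (T \<in> ?P \<and> A \<subseteq> T ! 1))"
    unfolding tabloids_two_row[of a b] by (subst sum.reindex) (auto simp: inj_on_def)
  also have "\<dots> = embed ?P (\<lambda>T. T ! 1) (raise ?X f) T"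
  proof (cases "T \<in> ?P")
    case True
    then have B: "T ! 1 \<subseteq> ?X" "card (T ! 1) = Suc b" using a by (auto simp: tabloids_two_row)
    then have fB: "finite (T ! 1)" using finite_subset by blast
    have "(\<Sum>A\<in>?S. f A * of_bool (T \<in> ?P \<and> A \<subseteq> T ! 1)) = (\<Sum>A | A \<subseteq> T ! 1 \<and> card A = b. f A)"
      using True B(1) by (intro sum.mono_neutral_cong_right) auto
    also have "{A. A \<subseteq> T ! 1 \<and> card A = b} = (\<lambda>x. T ! 1 - {x}) ` (T ! 1)"
    proof
      show "{A. A \<subseteq> T ! 1 \<and> card A = b} \<subseteq> (\<lambda>x. T ! 1 - {x}) ` (T ! 1)"
      proof clarify
        fix A assume A: "A \<subseteq> T ! 1" "b = card A"
        then have "card (T ! 1 - A) = 1" 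
          using B A card_Diff_subset[OF finite_subset[OF A(1) fB] A(1)] by simp
        then obtain x where "T ! 1 - A = {x}" by (auto simp: card_1_singleton_iff)
        then have "A = T ! 1 - {x}" "x \<in> T ! 1" using A by auto
        then show "A \<in> (\<lambda>x. T ! 1 - {x}) ` (T ! 1)" by blast
      qed
      show "(\<lambda>x. T ! 1 - {x}) ` (T ! 1) \<subseteq> {A. A \<subseteq> T ! 1 \<and> card A = b}"
      proof clarify
        fix x assume "x \<in> T ! 1"
        then show "T ! 1 - {x} \<subseteq> T ! 1 \<and> card (T ! 1 - {x}) = b"
          using B(2) fB card_Diff_singleton[of x "T ! 1"] by auto
      qed
    qed
    also have "(\<Sum>A\<in>(\<lambda>x. T ! 1 - {x}) ` (T ! 1). f A) = (\<Sum>x\<in>T ! 1. f (T ! 1 - {x}))"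
      by (subst sum.reindex) (auto simp: inj_on_def)
    finally show ?thesis using True B(1) by (simp add: embed_def raise_def)
  qed (simp add: embed_def)
  finally show "theta a b (embed (tabloids [a, b]) (\<lambda>T. T ! 1) f) T =
      embed ?P (\<lambda>T. T ! 1) (raise ?X f) T" .
qed

section \<open>Hook partitions\<close>

locale hook =
  fixes a r :: nat
  assumes a: "0 < a"
begin

definition shape :: "nat list" where "shape = a # replicate r 1"

text \<open>The first row without the corner. Each of these cells is alone in its column, so the
  column stabilizer fixes its entry.\<close>

definition arm :: "(nat \<times> nat) set" where "arm = {0} \<times> {1..<a}"

lemma sum_list_shape: "sum_list shape = a + r"
  by (simp add: shape_def sum_list_replicate)

lemma nth_shape: "shape ! 0 = a" "length shape = Suc r"
  by (simp_all add: shape_def)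

lemma mem_diagram: "(i, j) \<in> diagram shape \<longleftrightarrow> i = 0 \<and> j < a \<or> 1 \<le> i \<and> i \<le> r \<and> j = 0"
  by (cases i) (auto simp: diagram_def shape_def)

lemma arm_subset: "arm \<subseteq> diagram shape"
  by (auto simp: arm_def mem_diagram)

lemma column_arm:
  assumes "1 \<le> j" "j < a"
  shows "column shape t j = {t (0, j)}"
proof -
  have "{c \<in> diagram shape. snd c = j} = {(0, j)}"
    using assms by (auto simp: mem_diagram)
  then show ?thesis by (simp add: column_def)
qed

lemma column_leg:
  assumes t: "t \<in> tableaux shape"
  shows "column shape t 0 = {1..a + r} - t ` arm"
proof -
  have bij: "bij_betw t (diagram shape) {1..a + r}"
    using t by (simp add: tableaux_def sum_list_shape)
  have "{1..a + r} - t ` arm = t ` (diagram shape - arm)"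
    unfolding bij_betw_imp_surj_on[OF bij, symmetric]
    by (rule inj_on_image_set_diff[OF bij_betw_imp_inj_on[OF bij], symmetric]) (use arm_subset in auto)
  also have "diagram shape - arm = {c \<in> diagram shape. snd c = 0}"
    by (auto simp: mem_diagram arm_def)
  finally show ?thesis by (simp add: column_def)
qed

text \<open>The arm cells are columns of their own, and the first column holds all entries not in
  the arm.\<close>

lemma columns_eq_iff:
  assumes "s \<in> tableaux shape" "t \<in> tableaux shape"
  shows "(\<forall>j. column shape s j = column shape t j) \<longleftrightarrow> (\<forall>c\<in>arm. s c = t c)"
proof
  assume *: "\<forall>j. column shape s j = column shape t j"
  show "\<forall>c\<in>arm. s c = t c"
  proof
    fix c assume "c \<in> arm"
    then obtain j where j: "c = (0, j)" "1 \<le> j" "j < a" by (auto simp: arm_def)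
    have "{s (0, j)} = {t (0, j)}" using *[rule_format, of j] by (simp only: column_arm[OF j(2,3)])
    then show "s c = t c" using j(1) by simp
  qed
next
  assume *: "\<forall>c\<in>arm. s c = t c"
  show "\<forall>j. column shape s j = column shape t j"
  proof
    fix j
    consider "j = 0" | "1 \<le> j" "j < a" | "a \<le> j" by linarith
    then show "column shape s j = column shape t j"
    proof cases
      case 1
      have "s ` arm = t ` arm" using * by (intro image_cong) auto
      then show ?thesis unfolding 1 column_leg[OF assms(1)] column_leg[OF assms(2)] by simp
    next
      case 2
      have "(0, j) \<in> arm" using 2 by (simp add: arm_def)
      then show ?thesis using * by (simp add: column_arm[OF 2])
    next
      case 3
      then have "{c \<in> diagram shape. snd c = j} = {}" using a by (auto simp: mem_diagram)
      then show ?thesis unfolding column_def by (simp only: image_empty)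
    qed
  qed
qed

lemma row_0: "row shape t 0 = t ` insert (0, 0) arm"
proof -
  have "{c \<in> diagram shape. fst c = 0} = insert (0, 0) arm"
    using a by (auto simp: mem_diagram arm_def)
  then show ?thesis by (simp only: row_def)
qed

lemma row_leg:
  assumes "1 \<le> i" "i \<le> r"
  shows "row shape t i = {t (i, 0)}"
proof -
  have "{c \<in> diagram shape. fst c = i} = {(i, 0)}" using assms by (auto simp: mem_diagram)
  then show ?thesis by (simp add: row_def)
qed

lemma tabloid_of_nth: "i \<le> r \<Longrightarrow> tabloid_of shape t ! i = row shape t i"
  by (simp add: tabloid_of_def nth_shape del: upt_Suc)

text \<open>The rows of the leg are singletons, so the tabloid determines the leg; only the corner
  is left, and it must take the only remaining entry.\<close>

lemma tableau_unique:
  assumes s: "s \<in> tableaux shape" "s' \<in> tableaux shape" and arm: "\<forall>c\<in>arm. s c = s' c"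
    and eq: "tabloid_of shape s = tabloid_of shape s'" and c: "c \<in> diagram shape"
  shows "s c = s' c"
proof -
  have bij: "bij_betw s (diagram shape) {1..a + r}" "bij_betw s' (diagram shape) {1..a + r}"
    using s by (simp_all add: tableaux_def sum_list_shape)
  have leg: "s (i, 0) = s' (i, 0)" if "1 \<le> i" "i \<le> r" for i
  proof -
    have "{s (i, 0)} = {s' (i, 0)}"
      unfolding row_leg[OF that, symmetric] tabloid_of_nth[OF that(2), symmetric] eq ..
    then show ?thesis by simp
  qed
  have rest: "s c = s' c" if c: "c \<in> diagram shape" "c \<noteq> (0, 0)" for c
  proof (cases c)
    case (Pair i j)
    then consider "c \<in> arm" | "1 \<le> i" "i \<le> r" "j = 0"
      using c Pair by (auto simp: mem_diagram arm_def)
    then show ?thesis using arm leg Pair by cases auto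
  qed
  have corner: "(0, 0) \<in> diagram shape" using a by (simp add: mem_diagram)
  then have "s (0, 0) \<in> s' ` diagram shape"
    unfolding bij_betw_imp_surj_on[OF bij(2)] bij_betw_imp_surj_on[OF bij(1), symmetric] by blast
  then obtain d where d: "d \<in> diagram shape" "s (0, 0) = s' d" by blast
  have "d = (0, 0)"
  proof (rule ccontr)
    assume "d \<noteq> (0, 0)"
    then have "s (0, 0) = s d" using rest[OF d(1)] d(2) by simp
    then show False
      using inj_onD[OF bij_betw_imp_inj_on[OF bij(1)] _ corner d(1)] \<open>d \<noteq> (0, 0)\<close> by auto
  qed
  then show ?thesis using rest[OF c] d(2) by (cases "c = (0, 0)") simp_all
qed

text \<open>A first row containing the arm entries has exactly one further point, which has to sit
  in the corner. The leg can be in any order, since the column stabilizer permutes the first column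
  freely.\<close>

lemma orbit:
  assumes t: "t \<in> tableaux shape"
  shows "(\<exists>s \<in> tableaux shape. (\<forall>j. column shape s j = column shape t j) \<and> tabloid_of shape s = T)
    \<longleftrightarrow> T \<in> tabloids shape \<and> t ` arm \<subseteq> T ! 0" (is "?L \<longleftrightarrow> ?R")
proof
  assume ?L
  then obtain s where s: "s \<in> tableaux shape" "\<forall>j. column shape s j = column shape t j"
    "tabloid_of shape s = T" by blast
  have "s ` arm = t ` arm"
    using s(2) unfolding columns_eq_iff[OF s(1) t] by (intro image_cong) auto
  moreover have "T ! 0 = s ` insert (0, 0) arm"
    unfolding s(3)[symmetric] row_0[symmetric] by (rule tabloid_of_nth) simp
  moreover have "T \<in> tabloids shape" using s by (auto simp: tabloids_def)
  ultimately show ?R by auto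
next
  assume ?R
  then obtain s0 where s0: "s0 \<in> tableaux shape" "T = tabloid_of shape s0" and sub: "t ` arm \<subseteq> T ! 0"
    by (auto simp: tabloids_def)
  have bij: "bij_betw s0 (diagram shape) {1..a + r}" "bij_betw t (diagram shape) {1..a + r}"
    using s0(1) t by (simp_all add: tableaux_def sum_list_shape)
  have T0: "T ! 0 = s0 ` insert (0, 0) arm"
    unfolding s0(2) row_0[symmetric] by (rule tabloid_of_nth) simp
  have finarm: "finite arm" "card arm = a - 1"
    by (simp_all add: arm_def card_cartesian_product)
  have corner: "(0, 0) \<notin> arm" "insert (0, 0) arm \<subseteq> diagram shape"
    using arm_subset a by (auto simp: arm_def mem_diagram)
  have "card (T ! 0) = a"
    unfolding T0 using card_image[OF inj_on_subset[OF bij_betw_imp_inj_on[OF bij(1)] corner(2)]]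
      finarm corner(1) a by simp
  moreover have "card (t ` arm) = a - 1"
    using card_image[OF inj_on_subset[OF bij_betw_imp_inj_on[OF bij(2)] arm_subset]] finarm by simp
  ultimately have "card (T ! 0 - t ` arm) = 1"
    using card_Diff_subset[OF finite_imageI[OF finarm(1)] sub] a by simp
  then obtain z where z: "T ! 0 - t ` arm = {z}" by (auto simp: card_1_singleton_iff)
  \<comment> \<open>The arm is taken from \<open>t\<close>, the leg from a tableau of
    \<open>T\<close>, and the corner receives the leftover point of the first row.\<close>
  define s where "s c = (if c = (0, 0) then z else if c \<in> arm then t c else s0 c)" for c
  have img: "s ` insert (0, 0) arm = T ! 0"
  proof -
    have "s ` arm = t ` arm" using corner(1) by (intro image_cong) (auto simp: s_def)
    moreover have "s (0, 0) = z" by (simp add: s_def)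
    ultimately show ?thesis using z sub by auto
  qed
  have rest: "s ` (diagram shape - insert (0, 0) arm) = s0 ` (diagram shape - insert (0, 0) arm)"
    by (rule image_cong) (auto simp: s_def)
  have split: "diagram shape = insert (0, 0) arm \<union> (diagram shape - insert (0, 0) arm)"
    using corner(2) by blast
  have "s ` diagram shape = s0 ` diagram shape"
    by (subst (1 2) split) (simp only: image_Un img rest T0)
  then have surj: "s ` diagram shape = {1..a + r}"
    using bij_betw_imp_surj_on[OF bij(1)] by simp
  moreover have "inj_on s (diagram shape)"
    by (rule eq_card_imp_inj_on[OF finite_diagram])
      (simp only: surj, simp add: card_diagram sum_list_shape)
  ultimately have s: "s \<in> tableaux shape"
    by (simp add: tableaux_def bij_betw_def sum_list_shape)
  have "\<forall>c\<in>arm. s c = t c" using corner(1) by (auto simp: s_def)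
  moreover have "tabloid_of shape s = T"
  proof -
    have "row shape s i = row shape s0 i" if "i \<le> r" for i
    proof (cases "i = 0")
      case True
      then show ?thesis by (simp only: row_0 img T0)
    next
      case False
      then have "(i, 0) \<notin> insert (0, 0) arm" by (auto simp: arm_def)
      then show ?thesis using False that by (simp add: row_leg s_def)
    qed
    then show ?thesis unfolding s0(2) tabloid_of_def by (intro map_cong) (auto simp: nth_shape)
  qed
  ultimately show ?L using s columns_eq_iff[OF s t] by blast
qed

text \<open>The \<open>raise\<close> of the indicator of a set E is the indicator of the sets with
  one more element that contain E. By \<open>orbit\<close>, these are the first rows occurring in
  the polytabloid when E is the set of arm entries.\<close>

lemma polytabloid_hook:
  assumes char: "CHAR('a::field) = 2" and t: "t \<in> tableaux shape"
  shows "(polytabloid shape t :: tabloid \<Rightarrow> 'a) =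
    embed (tabloids shape) (\<lambda>T. T ! 0) (raise {1..a + r} (\<lambda>A. of_bool (A = t ` arm)))"
proof
  fix T
  interpret tabloid_key "a + r" a "tabloids shape" "\<lambda>T. T ! 0"
    using tabloid_key_tabloids[of shape "a + r" 0] by (simp add: sum_list_shape nth_shape)
  have "(polytabloid shape t :: tabloid \<Rightarrow> 'a) T =
      of_bool (\<exists>s \<in> tableaux shape. (\<forall>j. column shape s j = column shape t j) \<and> tabloid_of shape s = T)"
  proof (rule polytabloid_CHAR_2[OF char t])
    fix s s' c
    assume *: "s \<in> tableaux shape" "s' \<in> tableaux shape" "\<And>j. column shape s j = column shape t j"
      "\<And>j. column shape s' j = column shape t j"
      "tabloid_of shape s = tabloid_of shape s'" "c \<in> diagram shape"
    have "\<forall>c\<in>arm. s c = s' c" using *(3,4) columns_eq_iff[OF *(1,2)] by simp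
    then show "s c = s' c" using tableau_unique[OF *(1,2) _ *(5,6)] by blast
  qed
  also have "\<dots> = of_bool (T \<in> tabloids shape \<and> t ` arm \<subseteq> T ! 0)" unfolding orbit[OF t] ..
  also have "\<dots> = embed (tabloids shape) (\<lambda>T. T ! 0) (raise {1..a + r} (\<lambda>A. of_bool (A = t ` arm))) T"
  proof (cases "T \<in> tabloids shape")
    case True
    let ?B = "T ! 0" and ?E = "t ` arm"
    have "?B \<in> {A. A \<subseteq> {1..a + r} \<and> card A = a}" unfolding key_image[symmetric] using True by blast
    then have B: "?B \<subseteq> {1..a + r}" "card ?B = a" by auto
    have fB: "finite ?B" using B(1) finite_subset by blast
    have bij: "bij_betw t (diagram shape) {1..a + r}"
      using t by (simp add: tableaux_def sum_list_shape)
    have cE: "card ?E = a - 1" "finite ?E"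
      using card_image[OF inj_on_subset[OF bij_betw_imp_inj_on[OF bij] arm_subset]]
      by (simp_all add: arm_def card_cartesian_product)
    have "(\<Sum>x\<in>?B. of_bool (?B - {x} = ?E) :: 'a) = of_bool (?E \<subseteq> ?B)"
    proof (cases "?E \<subseteq> ?B")
      case sub: True
      then have "card (?B - ?E) = 1" using card_Diff_subset[OF cE(2) sub] B(2) cE(1) a by simp
      then obtain z where z: "?B - ?E = {z}" by (auto simp: card_1_singleton_iff)
      have "?B - {x} = ?E \<longleftrightarrow> x = z" if "x \<in> ?B" for x using z sub that by blast
      then have "(\<Sum>x\<in>?B. of_bool (?B - {x} = ?E) :: 'a) = (\<Sum>x\<in>?B. if x = z then 1 else 0)"
        by (intro sum.cong) auto
      moreover have "z \<in> ?B" using z by blast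
      ultimately show ?thesis using fB sub by simp
    next
      case False
      then have "?B - {x} \<noteq> ?E" for x by blast
      then show ?thesis using False by simp
    qed
    then show ?thesis using True B(1) by (simp add: embed_def raise_def)
  qed (simp add: embed_def)
  finally show "(polytabloid shape t :: tabloid \<Rightarrow> 'a) T =
    embed (tabloids shape) (\<lambda>T. T ! 0) (raise {1..a + r} (\<lambda>A. of_bool (A = t ` arm))) T" .
qed

lemma arms: "(\<lambda>t. t ` arm) ` tableaux shape = {E. E \<subseteq> {1..a + r} \<and> card E = a - 1}"
proof
  have carm: "card arm = a - 1" "finite arm" by (simp_all add: arm_def card_cartesian_product)
  show "(\<lambda>t. t ` arm) ` tableaux shape \<subseteq> {E. E \<subseteq> {1..a + r} \<and> card E = a - 1}"
  proof clarify
    fix t assume "t \<in> tableaux shape"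
    then have bij: "bij_betw t (diagram shape) {1..a + r}"
      by (simp add: tableaux_def sum_list_shape)
    show "t ` arm \<subseteq> {1..a + r} \<and> card (t ` arm) = a - 1"
      using card_image[OF inj_on_subset[OF bij_betw_imp_inj_on[OF bij] arm_subset]] carm(1)
        image_mono[OF arm_subset, of t] bij_betw_imp_surj_on[OF bij] by simp
  qed
  show "{E. E \<subseteq> {1..a + r} \<and> card E = a - 1} \<subseteq> (\<lambda>t. t ` arm) ` tableaux shape"
  proof clarify
    fix E assume E: "E \<subseteq> {1..a + r}" "card E = a - 1"
    have "finite E" using E(1) finite_subset by blast
    then obtain g where g: "bij_betw g arm E"
      using finite_same_card_bij[OF carm(2), of E] E(2) carm(1) by auto
    have "inj_on g arm" "g ` arm \<subseteq> {1..sum_list shape}"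
      using g E(1) by (simp_all add: bij_betw_def sum_list_shape)
    from tableau_extend[OF arm_subset this]
    obtain t where t: "t \<in> tableaux shape" "\<And>c. c \<in> arm \<Longrightarrow> t c = g c" by blast
    have "t ` arm = g ` arm" using t(2) by (rule image_cong[OF refl])
    then have "E = t ` arm" using g by (simp add: bij_betw_def)
    then show "E \<in> (\<lambda>t. t ` arm) ` tableaux shape" using t(1) by (rule image_eqI)
  qed
qed

end

section \<open>The hook Specht module as an image of the differential\<close>

lemma span_indicators:
  assumes X: "finite X"
  shows "fvec.span ((\<lambda>E A. of_bool (A = E)) ` {E. E \<subseteq> X \<and> card E = j}) = (homog X j :: ('b set \<Rightarrow> 'a::field) set)"
    (is "fvec.span (?d ` ?E) = _")
proof
  show "fvec.span (?d ` ?E) \<subseteq> (homog X j :: ('b set \<Rightarrow> 'a) set)"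
    by (rule fvec.span_minimal[OF _ subspace_homog]) (auto simp: homog_def)
  show "(homog X j :: ('b set \<Rightarrow> 'a) set) \<subseteq> fvec.span (?d ` ?E)"
  proof
    fix f :: "'b set \<Rightarrow> 'a" assume f: "f \<in> homog X j"
    have ev: "(\<Sum>E\<in>S. fscale (f E) (?d E)) A = (\<Sum>E\<in>S. if A = E then f E else 0)" for S A
      by (induction S rule: infinite_finite_induct) (auto simp: fscale_def)
    have eq: "f = (\<Sum>E\<in>?E. fscale (f E) (?d E))"
    proof
      fix A
      show "f A = (\<Sum>E\<in>?E. fscale (f E) (?d E)) A"
        unfolding ev using X f by (auto simp: homog_def)
    qed
    have "(\<Sum>E\<in>?E. fscale (f E) (?d E)) \<in> fvec.span (?d ` ?E)"
      by (intro fvec.span_sum fvec.span_scale fvec.span_base imageI)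
    then show "f \<in> fvec.span (?d ` ?E)" by (subst eq)
  qed
qed

text \<open>The arm entries of a tableau can form any set of size \<open>a - 1\<close>, and the
  indicators of these sets span the whole of \<open>homog\<close> in degree
  \<open>a - 1\<close>.\<close>

lemma specht_hook:
  assumes char: "CHAR('a::field) = 2" and a: "0 < a"
  shows "(specht (a # replicate r 1) :: (tabloid \<Rightarrow> 'a) set) =
    embed (tabloids (a # replicate r 1)) (\<lambda>T. T ! 0) ` raise {1..a + r} ` homog {1..a + r} (a - 1)"
proof -
  interpret hook a r using a by unfold_locales
  let ?d = "\<lambda>E A. of_bool (A = E) :: 'a"
  let ?H = "embed (tabloids shape) (\<lambda>T. T ! 0)" and ?R = "raise {1..a + r}"
  have "(polytabloid shape ` tableaux shape :: (tabloid \<Rightarrow> 'a) set) =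
      ?H ` ?R ` ?d ` {E. E \<subseteq> {1..a + r} \<and> card E = a - 1}"
    unfolding arms[symmetric] image_image
    by (rule image_cong[OF refl]) (rule polytabloid_hook[OF char])
  then have "(specht shape :: (tabloid \<Rightarrow> 'a) set) =
      ?H ` ?R ` fvec.span (?d ` {E. E \<subseteq> {1..a + r} \<and> card E = a - 1})"
    unfolding specht_def by (simp only: module_hom.span_image[OF module_hom_embed]
        module_hom.span_image[OF module_hom_raise])
  then show ?thesis
    unfolding shape_def[symmetric] span_indicators[OF finite_atLeastAtMost] .
qed

section \<open>The filtration\<close>

theorem theorem6p4:
  fixes n r :: nat
  assumes "CHAR('a::field) = 2"
    and "even n" and "n > 0" and "r \<le> n - 1" and "n - r \<le> r"
  shows "has_filtration n (specht ((n - r) # replicate r 1) :: (tabloid \<Rightarrow> 'a) set)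
    (specht_star r (n - r) #
     map (\<lambda>l. specht [r + 2 * l, n - r - 2 * l]) [1..<(n - r) div 2 + 1])"
proof -
  \<comment> \<open>Leaves \<open>1\<close> in shapes, rows and indices in the form in which the
    earlier lemmas are stated.\<close>
  note One_nat_def [simp del]
  note char = assms(1)
  define a where "a = n - r"
  have a: "0 < a" "a \<le> r" "n = a + r" using assms by (auto simp: a_def)
  let ?X = "{1..n}" and ?P = "tabloids (a # replicate r 1)"
  have X: "finite ?X" "even (card ?X)" "?X \<noteq> {}" using assms(2,3) by auto
  let ?Ws = "specht_star r a # map (\<lambda>l. specht [r + 2 * l, a - 2 * l]) [1..<a div 2 + 1] ::
    (tabloid \<Rightarrow> 'a) set list"
  interpret H: tabloid_key n a ?P "\<lambda>T. T ! 0"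
    using tabloid_key_tabloids[of "a # replicate r 1" n 0] a(3) by (simp add: sum_list_replicate)
  have two_row: "tabloid_key n q (tabloids [p, q]) (\<lambda>T. T ! 1)" if "p + q = n" for p q
    using tabloid_key_tabloids[of "[p, q]" n 1] that by simp
  define H where "H = (embed ?P (\<lambda>T. T ! 0) :: (nat set \<Rightarrow> 'a) \<Rightarrow> tabloid \<Rightarrow> 'a)"
  \<comment> \<open>By \<open>specht_hook\<close>, \<open>p\<close> maps all of M_(a-1) onto the
    hook Specht module, so the kernel filtration of M_(a-1) can be pushed forward along
    \<open>p\<close>.\<close>
  define p where "p f = H (raise ?X f)" for f
  have p_image: "p ` A = H ` raise ?X ` A" for A by (auto simp: p_def)
  let ?K = "\<lambda>i. kern ?X (a - 1) i :: (nat set \<Rightarrow> 'a) set"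
  \<comment> \<open>The index of \<open>?K\<close> drops by two per step, since every other step of
    the kernel filtration collapses under \<open>raise\<close>. It starts with \<open>a - 1\<close>
    at \<open>l = 1\<close>, and truncated subtraction makes it 0 at \<open>l = a div 2 + 1\<close>
    for either parity of \<open>a\<close>.\<close>
  define N where "N l = (if l = 0 then {0} else p ` ?K (a + 1 - 2 * l))" for l :: nat
  have homog: "raise ?X f \<in> homog ?X a" if "f \<in> ?K i" for f i
    using raise_homog[OF X(1), of f "a - 1"] that a(1) by (simp add: kern_def)
  have p_add: "p (f + g) = p f + p g" and p_scale: "p (fscale c f) = scale c (p f)" for f g c
    by (simp_all add: p_def H_def raise_add raise_scale embed_add embed_scale)
  have p_act: "p (act_set \<sigma> f) = act \<sigma> (p f)" if "\<sigma> permutes ?X" for \<sigma> f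
    by (simp only: p_def H_def raise_act_set[OF that] H.act_embed[OF that])
  have p_0: "p f = 0 \<longleftrightarrow> raise ?X f = 0" if "f \<in> ?K i" for f i
    using H.embed_eq_0_iff[OF homog[OF that]] by (simp add: p_def H_def)
  have sub: "tab.subspace (p ` ?K i)" for i
    by (rule subspace_image[OF p_add p_scale subspace_kern])
  have act_K: "act \<sigma> f \<in> p ` ?K i" if s: "\<sigma> permutes ?X" and f: "f \<in> p ` ?K i" for \<sigma> f i
  proof -
    obtain v where "v \<in> ?K i" "f = p v" using f by blast
    then have "act \<sigma> f = p (act_set \<sigma> v)" "act_set \<sigma> v \<in> ?K i"
      using p_act[OF s] act_set_kern[OF s] by simp_all
    then show ?thesis by (rule image_eqI)
  qed
  have act_0: "act \<sigma> (0 :: tabloid \<Rightarrow> 'a) = 0" for \<sigma> by (simp add: act_def fun_eq_iff)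
  have spechtV: "specht (a # replicate r 1) = p ` ?K 0"
    using specht_hook[OF char a(1), of r] a(3)
    by (simp add: kern_0 p_image H_def)
  have subN: "tab.subspace (N l)" for l by (simp add: N_def sub)
  have actN: "act \<sigma> f \<in> N l" if "\<sigma> permutes ?X" "f \<in> N l" for \<sigma> f l
    using that act_K by (auto simp: N_def act_0 split: if_splits)
  have mono: "p ` ?K i \<subseteq> p ` ?K i'" if "i' \<le> i" for i i'
    using kern_mono[OF that] by (rule image_mono)
  have submodule: "is_submodule n (N l) (specht (a # replicate r 1))" for l
  proof -
    have "N l \<subseteq> p ` ?K 0"
      using tab.subspace_0[OF sub, of 0] mono[of 0 "a + 1 - 2 * l"] by (auto simp: N_def)
    then show ?thesis using subN actN by (simp add: is_submodule_def spechtV)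
  qed
  have lift: "N l \<subseteq> N (Suc l)" for l
    using tab.subspace_0[OF sub] mono[of "a + 1 - 2 * Suc l" "a + 1 - 2 * l"] by (simp add: N_def)
  have bottom: "sn_isomorphic n (quotient_module (tab_module (N (Suc 0))) (N 0))
      (tab_module (specht_star r a :: (tabloid \<Rightarrow> 'a) set))"
  proof -
    interpret E: tabloid_key n a "tabloids [r, a]" "\<lambda>T. T ! 1" using two_row a(3) by simp
    \<comment> \<open>\<open>p\<close> and \<open>q\<close> are the same differential followed by
      two different embeddings of M_a, both injective, so they have the same kernel.\<close>
    define q where "q f = embed (tabloids [r, a]) (\<lambda>T. T ! 1) (raise ?X f)" for f :: "nat set \<Rightarrow> 'a"
    have n: "{1..r + 1 + (a - 1)} = ?X" "a - 1 + 1 = a" using a by auto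
    have "specht_star r a = theta (r + 1) (a - 1) ` embed (tabloids [r + 1, a - 1]) (\<lambda>T. T ! 1) ` ?K (a - 1)"
      unfolding specht_star_def using specht_two_row[OF char, of "a - 1" "r + 1"] a(2) n(1) by simp
    also have "\<dots> = q ` ?K (a - 1)"
      unfolding image_image
    proof (rule image_cong[OF refl])
      fix f assume "f \<in> ?K (a - 1)"
      then have "f \<in> homog {1..r + 1 + (a - 1)} (a - 1)" unfolding n(1) by (simp add: kern_def)
      from theta_embed[OF _ this]
      show "theta (r + 1) (a - 1) (embed (tabloids [r + 1, a - 1]) (\<lambda>T. T ! 1) f) = q f"
        unfolding n q_def by simp
    qed
    finally have star: "specht_star r a = q ` ?K (a - 1)" .
    have N1: "N (Suc 0) = p ` ?K (a - 1)" "N 0 = {0}" by (simp_all add: N_def One_nat_def)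
    show ?thesis
      unfolding N1 star
    proof (rule sn_isomorphic_quotient[where A = act_set, OF p_add p_scale _ _ subspace_kern])
      show "q (f + g) = q f + q g" "q (fscale c f) = scale c (q f)" for f g c
        by (simp_all add: q_def raise_add raise_scale embed_add embed_scale)
      show "q (act_set \<sigma> f) = act \<sigma> (q f)" if "\<sigma> permutes ?X" for \<sigma> f
        by (simp only: q_def raise_act_set[OF that] E.act_embed[OF that])
      show "p f \<in> {0} \<longleftrightarrow> q f = 0" if "f \<in> ?K (a - 1)" for f
        using p_0[OF that] E.embed_eq_0_iff[OF homog[OF that]] by (simp add: q_def)
    qed (simp_all add: p_act act_set_kern act_0)
  qed
  have higher: "sn_isomorphic n (quotient_module (tab_module (N (Suc l))) (N l))
      (tab_module (specht [r + 2 * l, a - 2 * l] :: (tabloid \<Rightarrow> 'a) set))"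
    if l: "1 \<le> l" "l \<le> a div 2" for l
  proof -
    define i where "i = a - 2 * l"
    have i: "a = i + 2 * l" using l by (simp add: i_def)
    interpret E: tabloid_key n i "tabloids [r + 2 * l, i]" "\<lambda>T. T ! 1"
      using two_row[of "r + 2 * l" i] a(3) i by simp
    define q where "q f = embed (tabloids [r + 2 * l, i]) (\<lambda>T. T ! 1) (level ?X i f)"
      for f :: "nat set \<Rightarrow> 'a"
    have level: "level ?X i ` ?K i = kern ?X i i"
      by (rule level_image_kern[OF char X(1)]) (use l a i in auto)
    have "q ` ?K i = embed (tabloids [r + 2 * l, i]) (\<lambda>T. T ! 1) ` level ?X i ` ?K i"
      by (auto simp: q_def)
    moreover have "r + 2 * l + i = n" "i \<le> r + 2 * l" using a i by simp_all
    ultimately have spechtq: "specht [r + 2 * l, i] = q ` ?K i"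
      using specht_two_row[OF char, of i "r + 2 * l"] by (simp add: level)
    \<comment> \<open>By definition the index is \<open>i - 1\<close>. The difference between
      \<open>a - 1\<close> and \<open>i - 1\<close> is \<open>2 * l\<close>, which is even and
      positive, so \<open>raise\<close> does not distinguish it from \<open>i\<close>; for
      \<open>i = 0\<close> truncation already gives index 0.\<close>
    have Suc_l: "N (Suc l) = p ` ?K i"
    proof (cases i)
      case 0
      then show ?thesis using i by (simp add: N_def)
    next
      case (Suc k)
      have "raise ?X ` ?K (Suc k) = raise ?X ` ?K k"
        by (rule raise_kern_Suc[OF char X(1,2)]) (use l a i Suc in auto)
      moreover have "a + 1 - 2 * Suc l = k" using i Suc by simp
      ultimately show ?thesis
        unfolding Suc by (simp add: N_def p_image)
    qed
    have "a + 1 - 2 * l = Suc i" "l \<noteq> 0" using i l by simp_all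
    then have N_l: "N l = p ` ?K (Suc i)" by (simp add: N_def)
    have ker: "p f \<in> N l \<longleftrightarrow> q f = 0" if f: "f \<in> ?K i" for f
    proof -
      \<comment> \<open>Injectivity of \<open>H\<close> on M_a reduces the question to subset
        functions; there \<open>a - 1 - i = 2 * l - 1\<close> is odd, so nothing is lost under
        \<open>raise\<close>.\<close>
      have "p f \<in> p ` ?K (Suc i) \<longleftrightarrow> raise ?X f \<in> raise ?X ` ?K (Suc i)"
        unfolding p_image p_def
      proof (rule inj_on_image_mem_iff)
        show "inj_on H (homog ?X a)" unfolding H_def by (rule H.inj_on_embed)
        show "raise ?X f \<in> homog ?X a" by (rule homog[OF f])
        show "raise ?X ` ?K (Suc i) \<subseteq> homog ?X a" using homog by blast
      qed
      also have "\<dots> \<longleftrightarrow> level ?X i f = 0"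
        by (rule raise_in_raise_kern_Suc_iff[OF char X _ f]) (use i l in auto)
      also have "\<dots> \<longleftrightarrow> q f = 0"
        using E.embed_eq_0_iff[of "level ?X i f"] level_in_kern[OF X(1) f] by (simp add: q_def kern_def)
      finally show ?thesis unfolding N_l .
    qed
    show ?thesis
      unfolding Suc_l spechtq i_def[symmetric]
    proof (rule sn_isomorphic_quotient[where A = act_set, OF p_add p_scale _ _ subspace_kern subN])
      show "q (f + g) = q f + q g" "q (fscale c f) = scale c (q f)" for f g c
        by (simp_all add: q_def level_add level_scale embed_add embed_scale)
      show "q (act_set \<sigma> f) = act \<sigma> (q f)" if "\<sigma> permutes ?X" for \<sigma> f
        by (simp only: q_def level_act_set[OF that] E.act_embed[OF that])
    qed (simp_all add: p_act act_set_kern actN ker)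
  qed
  have top: "N (length ?Ws) = specht (a # replicate r 1)"
    by (simp add: N_def spechtV)
  have "sn_isomorphic n (quotient_module (tab_module (N (Suc l))) (N l)) (tab_module (?Ws ! l))"
    if "l < length ?Ws" for l
  proof (cases l)
    case 0
    then show ?thesis using bottom by simp
  next
    case (Suc k)
    have "?Ws ! l = specht [r + 2 * l, a - 2 * l]" using that Suc by (simp del: upt_Suc)
    then show ?thesis using higher[of l] that Suc by simp
  qed
  then have "has_filtration n (specht (a # replicate r 1)) ?Ws"
    unfolding has_filtration_def using top submodule lift
    by (intro exI[of _ N]) (simp add: N_def)
  then show ?thesis unfolding a_def .
qed

end
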